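(* For each $\beta\in(0,1/2]$ and each odd positive integer $p$, let $X_n$ be the random process on the integers mod $p$ given by $X_0=0$ and $X_{n+1}=2X_n+b_n\pmod p$, where $b_0,b_1,b_2,\dots$ are i.i.d. with $\Pr(b_n=1)=\Pr(b_n=-1)=\beta$ and $\Pr(b_n=0)=1-2\beta$. Let $P_n(s)=\Pr(X_n=s)$ for $s\in\mathbb{Z}/p\mathbb{Z}$ (so $P_n$ depends on $\beta$ and $p$), and let $U$ be the uniform distribution on $\mathbb{Z}/p\mathbb{Z}$. Then there exist constants $c_\beta>0$, one for each $\beta\in(0,1/2]\setminus\{1/4,1/2\}$, with $c_\beta\to\infty$ as $\beta\to0^+$, such that for each such $\beta$: if $p=2^t-1$ and $n\le c_\beta(\log p)\log(\log p)$, then $\|P_n-U\|\to1$ as $t\to\infty$; that is, for every $\varepsilon>0$ there is $t_0$ (depending on $\beta$ and $\varepsilon$) such that for all integers $t\ge t_0$, with $p=2^t-1$, and all integers $n$ with $0\le n\le c_\beta(\log p)\log(\log p)$, one has $\|P_n-U\|>1-\varepsilon$.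
   Context: For a probability $P$ on a finite group $G$, the variation distance from the uniform distribution $U$ on $G$ is $\|P-U\|=\frac12\sum_{s\in G}\left|P(s)-1/|G|\right|=\max_{A\subseteq G}|P(A)-U(A)|$. Here $\log$ denotes the natural logarithm. *)

theory Defs
  imports "HOL-Probability.Probability"
begin

text \<open>The integers mod \<open>p\<close> are represented by the residues \<open>{0..<int p}\<close>.\<close>

definition residues_mod :: "nat \<Rightarrow> int set" where
  "residues_mod p = {0..<int p}"

definition step_pmf :: "real \<Rightarrow> int pmf" where
  "step_pmf \<beta> = pmf_of_list [(1, \<beta>), (-1, \<beta>), (0, 1 - 2 * \<beta>)]"

text \<open>Outside \<open>0 \<le> \<beta> \<le> 1/2\<close> the list of weights is not a distribution and \<^const>\<open>step_pmf\<close>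
  is unspecified; inside this range it has the intended point masses.\<close>

lemma pmf_step_pmf:
  assumes "0 \<le> \<beta>" "\<beta> \<le> 1 / 2"
  shows "pmf (step_pmf \<beta>) 1 = \<beta>" "pmf (step_pmf \<beta>) (-1) = \<beta>"
    "pmf (step_pmf \<beta>) 0 = 1 - 2 * \<beta>"
proof -
  have "pmf_of_list_wf [(1::int, \<beta>), (-1, \<beta>), (0, 1 - 2 * \<beta>)]"
    using assms by (intro pmf_of_list_wfI) auto
  then show "pmf (step_pmf \<beta>) 1 = \<beta>" "pmf (step_pmf \<beta>) (-1) = \<beta>"
    "pmf (step_pmf \<beta>) 0 = 1 - 2 * \<beta>"
    by (simp_all add: step_pmf_def pmf_pmf_of_list)
qed

text \<open>The i.i.d. sequence is realised canonically: a point \<open>b\<close> of the product space is a whole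
  sequence of steps and \<open>b n\<close> is its \<open>n\<close>-th step.\<close>

definition step_space :: "real \<Rightarrow> (nat \<Rightarrow> int) measure" where
  "step_space \<beta> = (\<Pi>\<^sub>M n\<in>UNIV. measure_pmf (step_pmf \<beta>))"

primrec walk :: "nat \<Rightarrow> nat \<Rightarrow> (nat \<Rightarrow> int) \<Rightarrow> int" where
  "walk p 0 b = 0"
| "walk p (Suc n) b = (2 * walk p n b + b n) mod int p"

definition walk_law :: "real \<Rightarrow> nat \<Rightarrow> nat \<Rightarrow> int \<Rightarrow> real" where
  "walk_law \<beta> p n s = measure (step_space \<beta>) {b \<in> space (step_space \<beta>). walk p n b = s}"

lemma prob_space_step_space: "prob_space (step_space \<beta>)"
  unfolding step_space_def by (intro prob_space_PiM measure_pmf.prob_space_axioms)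

lemma measurable_step: "(\<lambda>b. b n) \<in> step_space \<beta> \<rightarrow>\<^sub>M count_space UNIV"
proof -
  have "(\<lambda>b. b n) \<in> step_space \<beta> \<rightarrow>\<^sub>M measure_pmf (step_pmf \<beta>)"
    unfolding step_space_def by (rule measurable_component_singleton) simp
  then show ?thesis by simp
qed

text \<open>The steps are independent with common law \<^term>\<open>step_pmf \<beta>\<close>.\<close>

lemma distr_step: "distr (step_space \<beta>) (count_space UNIV) (\<lambda>b. b n) = measure_pmf (step_pmf \<beta>)"
proof -
  have "distr (step_space \<beta>) (measure_pmf (step_pmf \<beta>)) (\<lambda>b. b n) = measure_pmf (step_pmf \<beta>)"
    unfolding step_space_def
    by (rule distr_PiM_component) (auto intro: measure_pmf.prob_space_axioms)
  moreover have "distr (step_space \<beta>) (count_space UNIV) (\<lambda>b. b n) =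
      distr (step_space \<beta>) (measure_pmf (step_pmf \<beta>)) (\<lambda>b. b n)"
    by (rule distr_cong) auto
  ultimately show ?thesis by simp
qed

lemma indep_steps:
  "prob_space.indep_vars (step_space \<beta>) (\<lambda>_. count_space UNIV) (\<lambda>n b. b n) UNIV"
proof -
  interpret prob_space "step_space \<beta>" by (rule prob_space_step_space)
  have "distr (step_space \<beta>) (\<Pi>\<^sub>M n\<in>UNIV. count_space UNIV) (\<lambda>b. \<lambda>n\<in>UNIV. b n) =
      distr (step_space \<beta>) (step_space \<beta>) (\<lambda>b. b)"
    by (rule distr_cong) (auto simp: step_space_def intro!: sets_PiM_cong)
  also have "\<dots> = (\<Pi>\<^sub>M n\<in>UNIV. distr (step_space \<beta>) (count_space UNIV) (\<lambda>b. b n))"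
    by (simp add: distr_step distr_id) (simp add: step_space_def)
  finally show ?thesis
    by (subst indep_vars_iff_distr_eq_PiM) (auto intro: measurable_step)
qed

lemma measurable_walk: "walk p n \<in> step_space \<beta> \<rightarrow>\<^sub>M count_space UNIV"
proof (induction n)
  case 0
  have "walk p 0 = (\<lambda>_. 0)" by auto
  then show ?case by simp
next
  case (Suc n)
  have "(\<lambda>b. (2 * i + b n) mod int p) \<in> step_space \<beta> \<rightarrow>\<^sub>M count_space UNIV" for i
    by (rule measurable_compose[OF measurable_step]) simp
  from measurable_compose_countable[OF this Suc] show ?case by simp
qed

definition uniform_on :: "'a set \<Rightarrow> 'a \<Rightarrow> real" where
  "uniform_on G s = 1 / real (card G)"

definition variation_distance :: "'a set \<Rightarrow> ('a \<Rightarrow> real) \<Rightarrow> ('a \<Rightarrow> real) \<Rightarrow> real" where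
  "variation_distance G P Q = (1 / 2) * (\<Sum>s\<in>G. \<bar>P s - Q s\<bar>)"

end

theory Submission
  imports Defs "HOL-Library.Real_Mod" "HOL-Real_Asymp.Real_Asymp"
begin

text \<open>Second moment argument. The Fourier transform of \<open>P\<^sub>n\<close> at \<open>k\<close> is the product of
  \<open>g(2\<^sup>j k / p)\<close> over \<open>j < n\<close>, where \<open>g(x) = 1 - 4 \<beta> sin\<^sup>2(\<pi> x)\<close>. For \<open>p = 2\<^sup>t - 1\<close> multiplication by 2
  has order \<open>t\<close> mod \<open>p\<close>, and the distance is nonincreasing in \<open>n\<close>, so it suffices
  to treat \<open>n = r t\<close>. There the transform equals \<open>G(k)\<^sup>r\<close>, where \<open>G(k)\<close> is the product over one
  period. The test function \<open>f(s)\<close>, the sum of \<open>exp(2 \<pi> i 2\<^sup>j s / p)\<close> over \<open>j < t\<close>, has mean 0 and second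
  moment \<open>t\<close> under \<open>U\<close>. Under \<open>P\<^sub>n\<close> its mean is \<open>m = t G(1)\<^sup>r\<close> and its second moment is \<open>t\<close> times the sum
  of \<open>G(2\<^sup>d - 1)\<^sup>r\<close> over \<open>d < t\<close>; this is \<open>(1 + o(1)) m\<^sup>2\<close>, because \<open>G(2\<^sup>d - 1)\<close> is within
  \<open>O(2\<^sup>-\<^sup>d + 2\<^sup>d\<^sup>-\<^sup>t)\<close> of \<open>G(1)\<^sup>2\<close>. If \<open>\<bar>G(1)\<bar> \<ge> \<gamma> > 0\<close> and \<open>r\<close> is at most about
  \<open>log t / (4 log (1/\<gamma>))\<close>, then also \<open>t = o(m\<^sup>2)\<close>, so \<open>f\<close> separates \<open>P\<^sub>n\<close> from \<open>U\<close>. Such a \<open>\<gamma>\<close> exists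
  because the limiting factors \<open>g(1/2) = 1 - 4 \<beta>\<close> and \<open>g(1/4) = 1 - 2 \<beta>\<close> do not vanish, and
  \<open>\<gamma> = 1 - 54 \<beta>\<close> works for small \<open>\<beta>\<close>.\<close>

subsection \<open>Residues\<close>

lemma finite_residues_mod [simp]: "finite (residues_mod p)"
  by (simp add: residues_mod_def)

lemma card_residues_mod [simp]: "card (residues_mod p) = p"
  by (simp add: residues_mod_def)

lemma mod_in_residues_mod: "p > 0 \<Longrightarrow> k mod int p \<in> residues_mod p"
  by (simp add: residues_mod_def)

text \<open>For \<open>a\<close> a unit mod \<open>p\<close> the affine map is injective on the
  residues, so it permutes this finite set. It serves with \<open>a = 2\<close> for odd
  \<open>p\<close> and with \<open>a = 1\<close> for a shift.\<close>

lemma sum_residues_mod_affine: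
  fixes F :: "int \<Rightarrow> 'a :: comm_monoid_add"
  assumes "p > 0" "coprime a (int p)"
  shows "(\<Sum>x\<in>residues_mod p. F ((a * x + b) mod int p)) = (\<Sum>x\<in>residues_mod p. F x)"
proof -
  let ?h = "\<lambda>x. (a * x + b) mod int p"
  have inj: "inj_on ?h (residues_mod p)"
  proof (rule inj_onI)
    fix x y assume xy: "x \<in> residues_mod p" "y \<in> residues_mod p" "?h x = ?h y"
    then have "int p dvd a * (x - y)"
      by (simp add: mod_eq_dvd_iff algebra_simps)
    then have "int p dvd x - y"
      using assms(2) by (simp add: coprime_commute coprime_dvd_mult_right_iff)
    then have "x mod int p = y mod int p" by (simp add: mod_eq_dvd_iff)
    then show "x = y" using xy by (simp add: residues_mod_def)
  qed
  have "?h ` residues_mod p = residues_mod p"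
    using inj assms(1) by (intro endo_inj_surj) (auto intro: mod_in_residues_mod)
  with inj show ?thesis
    by (metis (no_types, lifting) sum.reindex_cong)
qed

subsection \<open>The law of the walk\<close>

lemma set_pmf_step_pmf:
  assumes "0 \<le> \<beta>" "\<beta> \<le> 1 / 2"
  shows "set_pmf (step_pmf \<beta>) \<subseteq> {-1, 0, 1}"
proof -
  have "pmf_of_list_wf [(1::int, \<beta>), (-1, \<beta>), (0, 1 - 2 * \<beta>)]"
    using assms by (intro pmf_of_list_wfI) auto
  from set_pmf_of_list[OF this] show ?thesis by (auto simp: step_pmf_def)
qed

lemma space_step_space [simp]: "space (step_space \<beta>) = UNIV"
  by (auto simp: step_space_def space_PiM)

lemma walk_in_residues_mod: "p > 0 \<Longrightarrow> walk p n b \<in> residues_mod p"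
  by (cases n) (auto simp: residues_mod_def)

lemma walk_cong: "(\<And>i. i < n \<Longrightarrow> b i = b' i) \<Longrightarrow> walk p n b = walk p n b'"
  by (induction n) auto

text \<open>Measurability with respect to the first \<open>n\<close> coordinates alone, which is
  what the independence of \<open>walk p n\<close> from step \<open>n\<close> rests on.\<close>

lemma measurable_walk_PiM:
  assumes "m \<le> n"
  shows "walk p m \<in> (\<Pi>\<^sub>M i\<in>{..<n}. count_space UNIV) \<rightarrow>\<^sub>M count_space UNIV"
  using assms
proof (induction m)
  case 0
  have "walk p 0 = (\<lambda>_. 0)" by auto
  then show ?case by simp
next
  case (Suc m)
  have "(\<lambda>b. b m) \<in> (\<Pi>\<^sub>M i\<in>{..<n}. count_space (UNIV :: int set)) \<rightarrow>\<^sub>M count_space UNIV"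
    using Suc.prems by (intro measurable_component_singleton) auto
  then have "(\<lambda>b. (2 * i + b m) mod int p)
      \<in> (\<Pi>\<^sub>M i\<in>{..<n}. count_space UNIV) \<rightarrow>\<^sub>M count_space UNIV" for i
    by (rule measurable_compose) simp
  from measurable_compose_countable[OF this Suc.IH] Suc.prems show ?case by simp
qed

text \<open>\<open>walk p n\<close> is a function of the steps with index below \<open>n\<close>,
  hence independent of step \<open>n\<close>.\<close>

lemma prob_walk_step:
  "measure (step_space \<beta>) {\<omega>. walk p n \<omega> = x \<and> \<omega> n = b} = walk_law \<beta> p n x * pmf (step_pmf \<beta>) b"
proof -
  interpret prob_space "step_space \<beta>" by (rule prob_space_step_space)
  have "indep_var (\<Pi>\<^sub>M i\<in>{..<n}. count_space UNIV) (\<lambda>\<omega>. restrict (\<lambda>i. \<omega> i) {..<n})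
      (\<Pi>\<^sub>M i\<in>{n}. count_space UNIV) (\<lambda>\<omega>. restrict (\<lambda>i. \<omega> i) {n})"
    by (rule indep_var_restrict[OF indep_steps]) auto
  then have "indep_var (count_space UNIV) (walk p n \<circ> (\<lambda>\<omega>. restrict (\<lambda>i. \<omega> i) {..<n}))
      (count_space UNIV) ((\<lambda>\<omega>. \<omega> n) \<circ> (\<lambda>\<omega>. restrict (\<lambda>i. \<omega> i) {n}))"
    by (rule indep_var_compose) (auto intro: measurable_walk_PiM measurable_component_singleton)
  moreover have "walk p n \<circ> (\<lambda>\<omega>. restrict (\<lambda>i. \<omega> i) {..<n}) = walk p n"
    by (rule ext, simp, rule walk_cong) simp
  moreover have "(\<lambda>\<omega>. \<omega> n) \<circ> (\<lambda>\<omega>. restrict (\<lambda>i. \<omega> i) {n}) = (\<lambda>\<omega>. \<omega> n :: int)"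
    by auto
  ultimately have "indep_var (count_space UNIV) (walk p n) (count_space UNIV) (\<lambda>\<omega>. \<omega> n)"
    by simp
  from indep_varD[OF this, of "{x}" "{b}"]
  have "prob {\<omega>. walk p n \<omega> = x \<and> \<omega> n = b} = prob {\<omega>. walk p n \<omega> = x} * prob {\<omega>. \<omega> n = b}"
    by (simp add: vimage_def)
  also have "prob {\<omega>. \<omega> n = b} = measure (distr (step_space \<beta>) (count_space UNIV) (\<lambda>\<omega>. \<omega> n)) {b}"
    by (subst measure_distr) (auto intro: measurable_step simp: vimage_def)
  finally show ?thesis
    by (simp add: distr_step walk_law_def measure_pmf_single)
qed

lemma walk_law_0: "walk_law \<beta> p 0 s = (if s = 0 then 1 else 0)"
proof -
  interpret prob_space "step_space \<beta>" by (rule prob_space_step_space)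
  show ?thesis using prob_space by (auto simp: walk_law_def)
qed

lemma walk_law_nonneg: "walk_law \<beta> p n s \<ge> 0"
  by (simp add: walk_law_def)

lemma walk_law_Suc:
  assumes "0 \<le> \<beta>" "\<beta> \<le> 1 / 2" "p > 0"
  shows "walk_law \<beta> p (Suc n) s = (\<Sum>x\<in>residues_mod p. \<Sum>b\<in>{-1, 0, 1}.
    if (2 * x + b) mod int p = s then walk_law \<beta> p n x * pmf (step_pmf \<beta>) b else 0)"
proof -
  interpret prob_space "step_space \<beta>" by (rule prob_space_step_space)
  define E where "E = (\<lambda>(x, b). {\<omega>. walk p n \<omega> = x \<and> \<omega> n = b \<and> (2 * x + b) mod int p = s})"
  have sets: "E y \<in> events" for y
  proof -
    have "{\<omega> \<in> space (step_space \<beta>). walk p n \<omega> = fst y \<and> \<omega> n = snd y} \<in> events"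
      using measurable_sets[OF measurable_walk[of p n \<beta>], of "{fst y}"]
        measurable_sets[OF measurable_step[of n \<beta>], of "{snd y}"]
      by (auto simp: vimage_def Collect_conj_eq)
    moreover have "E y = (if (2 * fst y + snd y) mod int p = s
        then {\<omega> \<in> space (step_space \<beta>). walk p n \<omega> = fst y \<and> \<omega> n = snd y} else {})"
      by (auto simp: E_def split: prod.splits)
    ultimately show ?thesis by simp
  qed
  \<comment> \<open>Points of \<open>step_space \<beta>\<close> are arbitrary integer sequences.
    Steps outside \<open>{-1, 0, 1}\<close> form a null event, so the sets \<open>E y\<close>
    exhaust the event in question only almost everywhere.\<close>
  have "AE y in distr (step_space \<beta>) (count_space UNIV) (\<lambda>\<omega>. \<omega> n). y \<in> {-1, 0, 1}"
    unfolding distr_step using set_pmf_step_pmf[OF assms(1,2)] by (auto simp: AE_measure_pmf_iff)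
  then have AE: "AE \<omega> in step_space \<beta>. \<omega> n \<in> {-1, 0, 1}"
    by (subst (asm) AE_distr_iff) (auto intro: measurable_step)
  have "walk_law \<beta> p (Suc n) s = prob (\<Union>y\<in>residues_mod p \<times> {-1, 0, 1}. E y)"
    unfolding walk_law_def
  proof (rule measure_eq_AE)
    show "AE \<omega> in step_space \<beta>. \<omega> \<in> {b \<in> space (step_space \<beta>). walk p (Suc n) b = s}
        \<longleftrightarrow> \<omega> \<in> (\<Union>y\<in>residues_mod p \<times> {-1, 0, 1}. E y)"
      using AE by eventually_elim (auto simp: E_def walk_in_residues_mod assms(3))
    show "{b \<in> space (step_space \<beta>). walk p (Suc n) b = s} \<in> events"
      using measurable_sets[OF measurable_walk[of p "Suc n" \<beta>], of "{s}"]
      by (simp add: vimage_def del: walk.simps)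
  qed (use sets in auto)
  also have "\<dots> = (\<Sum>y\<in>residues_mod p \<times> {-1, 0, 1}. prob (E y))"
    using sets by (intro finite_measure_finite_Union) (auto simp: E_def disjoint_family_on_def)
  also have "\<dots> = (\<Sum>(x, b)\<in>residues_mod p \<times> {-1, 0, 1}.
      if (2 * x + b) mod int p = s then walk_law \<beta> p n x * pmf (step_pmf \<beta>) b else 0)"
    by (intro sum.cong) (auto simp: E_def prob_walk_step)
  finally show ?thesis by (simp only: sum.cartesian_product)
qed

text \<open>The transition rule in dual form: the expectation of \<open>F\<close> after a step is
  the expectation of its one-step average. The values of \<open>F\<close> may be complex, as needed
  for characters.\<close>

lemma sum_walk_law_Suc:
  fixes F :: "int \<Rightarrow> 'a :: real_algebra_1"
  assumes "0 \<le> \<beta>" "\<beta> \<le> 1 / 2" "p > 0"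
  shows "(\<Sum>s\<in>residues_mod p. of_real (walk_law \<beta> p (Suc n) s) * F s) =
    (\<Sum>x\<in>residues_mod p. of_real (walk_law \<beta> p n x) *
      (\<Sum>b\<in>{-1, 0, 1}. of_real (pmf (step_pmf \<beta>) b) * F ((2 * x + b) mod int p)))"
proof -
  let ?w = "\<lambda>x b. walk_law \<beta> p n x * pmf (step_pmf \<beta>) b"
  have "(\<Sum>s\<in>residues_mod p. of_real (walk_law \<beta> p (Suc n) s) * F s) =
      (\<Sum>s\<in>residues_mod p. \<Sum>x\<in>residues_mod p. \<Sum>b\<in>{-1, 0, 1}.
        if (2 * x + b) mod int p = s then of_real (?w x b) * F s else 0)"
    unfolding walk_law_Suc[OF assms] of_real_sum sum_distrib_right
    by (intro sum.cong refl) auto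
  also have "\<dots> = (\<Sum>x\<in>residues_mod p. \<Sum>b\<in>{-1, 0, 1}. \<Sum>s\<in>residues_mod p.
        if (2 * x + b) mod int p = s then of_real (?w x b) * F s else 0)"
    by (subst sum.swap) (intro sum.cong refl sum.swap)
  also have "\<dots> = (\<Sum>x\<in>residues_mod p. \<Sum>b\<in>{-1, 0, 1}. of_real (?w x b) * F ((2 * x + b) mod int p))"
    by (intro sum.cong refl) (subst sum.delta', auto simp: mod_in_residues_mod assms)
  finally show ?thesis
    by (simp add: sum_distrib_left mult.assoc del: sum.insert)
qed

text \<open>Doubling mod an odd \<open>p\<close> is a bijection, so the uniform law is stationary,
  and a transition kernel does not increase the l1 distance between two laws.\<close>

lemma variation_distance_walk_law_Suc:
  assumes "0 \<le> \<beta>" "\<beta> \<le> 1 / 2" "odd p"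
  shows "variation_distance (residues_mod p) (walk_law \<beta> p (Suc n)) (uniform_on (residues_mod p))
    \<le> variation_distance (residues_mod p) (walk_law \<beta> p n) (uniform_on (residues_mod p))"
proof -
  let ?R = "residues_mod p" and ?w = "pmf (step_pmf \<beta>)" and ?P = "walk_law \<beta> p"
  have p: "p > 0" using assms(3) by (auto intro: Nat.gr0I)
  have w: "(\<Sum>b\<in>{-1, 0, 1}. ?w b) = 1"
    using set_pmf_step_pmf[OF assms(1,2)] by (intro sum_pmf_eq_1) auto
  \<comment> \<open>Stationarity: for each fixed \<open>b\<close> exactly one residue
    \<open>x\<close> is mapped to \<open>s\<close>.\<close>
  have u: "1 / real p = (\<Sum>x\<in>?R. \<Sum>b\<in>{-1, 0, 1}.
      if (2 * x + b) mod int p = s then 1 / real p * ?w b else 0)" if "s \<in> ?R" for s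
  proof -
    have "(\<Sum>x\<in>?R. \<Sum>b\<in>{-1, 0, 1}. if (2 * x + b) mod int p = s then 1 / real p * ?w b else 0) =
      (\<Sum>b\<in>{-1, 0, 1}. \<Sum>x\<in>?R. if (2 * x + b) mod int p = s then 1 / real p * ?w b else 0)"
      by (rule sum.swap)
    also have "\<dots> = (\<Sum>b\<in>{-1, 0, 1}. \<Sum>x\<in>?R. if x = s then 1 / real p * ?w b else 0)"
    proof (rule sum.cong[OF refl])
      fix b
      show "(\<Sum>x\<in>?R. if (2 * x + b) mod int p = s then 1 / real p * ?w b else 0) =
          (\<Sum>x\<in>?R. if x = s then 1 / real p * ?w b else 0)"
        using sum_residues_mod_affine[OF p, of 2 "\<lambda>x. if x = s then 1 / real p * ?w b else 0" b] assms(3)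
        by (simp add: coprime_left_2_iff_odd)
    qed
    also have "\<dots> = (\<Sum>b\<in>{-1, 0, 1}. 1 / real p * ?w b)"
      using that by (intro sum.cong refl) (simp add: sum.delta')
    also have "\<dots> = 1 / real p" by (subst sum_distrib_left[symmetric]) (simp only: w mult_1_right)
    finally show ?thesis by simp
  qed
  have "\<bar>?P (Suc n) s - 1 / real p\<bar> \<le> (\<Sum>x\<in>?R. \<Sum>b\<in>{-1, 0, 1}.
      if (2 * x + b) mod int p = s then \<bar>?P n x - 1 / real p\<bar> * ?w b else 0)" if "s \<in> ?R" for s
  proof -
    have eq: "?P (Suc n) s - 1 / real p = (\<Sum>x\<in>?R. \<Sum>b\<in>{-1, 0, 1}.
      if (2 * x + b) mod int p = s then (?P n x - 1 / real p) * ?w b else 0)"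
      by (subst u[OF that], subst walk_law_Suc[OF assms(1,2) p], unfold sum_subtractf[symmetric],
          intro sum.cong refl) (simp add: left_diff_distrib)
    have "\<bar>if c then (?P n x - 1 / real p) * ?w b else 0\<bar> =
        (if c then \<bar>?P n x - 1 / real p\<bar> * ?w b else 0)" for c x b
      by (simp add: abs_mult)
    then show ?thesis
      unfolding eq by (intro sum_abs[THEN order.trans] sum_mono) (simp del: sum.insert)
  qed
  then have "(\<Sum>s\<in>?R. \<bar>?P (Suc n) s - 1 / real p\<bar>) \<le> (\<Sum>s\<in>?R. \<Sum>x\<in>?R. \<Sum>b\<in>{-1, 0, 1}.
      if (2 * x + b) mod int p = s then \<bar>?P n x - 1 / real p\<bar> * ?w b else 0)"
    by (rule sum_mono)
  also have "\<dots> = (\<Sum>x\<in>?R. \<Sum>b\<in>{-1, 0, 1}. \<Sum>s\<in>?R.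
      if (2 * x + b) mod int p = s then \<bar>?P n x - 1 / real p\<bar> * ?w b else 0)"
    by (subst sum.swap) (intro sum.cong refl sum.swap)
  \<comment> \<open>Each pair \<open>(x, b)\<close> reaches exactly one residue \<open>s\<close>;
    the weights of \<open>b\<close> then sum to 1.\<close>
  also have "\<dots> = (\<Sum>x\<in>?R. \<Sum>b\<in>{-1, 0, 1}. \<bar>?P n x - 1 / real p\<bar> * ?w b)"
    by (intro sum.cong refl) (subst sum.delta', auto simp: mod_in_residues_mod p)
  also have "\<dots> = (\<Sum>x\<in>?R. \<bar>?P n x - 1 / real p\<bar>)"
    using w by (simp add: sum_distrib_left[symmetric] del: sum.insert)
  finally show ?thesis by (simp add: variation_distance_def uniform_on_def)
qed

lemma variation_distance_walk_law_antimono: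
  assumes "0 \<le> \<beta>" "\<beta> \<le> 1 / 2" "odd p" "m \<le> n"
  shows "variation_distance (residues_mod p) (walk_law \<beta> p n) (uniform_on (residues_mod p))
    \<le> variation_distance (residues_mod p) (walk_law \<beta> p m) (uniform_on (residues_mod p))"
  using assms(4)
  by (induction rule: dec_induct)
    (auto intro: order.trans[OF variation_distance_walk_law_Suc[OF assms(1-3)]])

subsection \<open>Fourier analysis\<close>

definition chi :: "nat \<Rightarrow> int \<Rightarrow> complex" where
  "chi p k = cis (2 * pi * (of_int k / of_nat p))"

lemma chi_add: "chi p (k + l) = chi p k * chi p l"
  by (simp add: chi_def cis_mult add_divide_distrib distrib_left)

lemma chi_0 [simp]: "chi p 0 = 1"
  by (simp add: chi_def)

lemma cnj_chi: "cnj (chi p k) = chi p (- k)"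
  by (simp add: chi_def cis_cnj)

lemma chi_eq_1_iff: "p > 0 \<Longrightarrow> chi p k = 1 \<longleftrightarrow> int p dvd k"
proof
  assume p: "p > 0" and "chi p k = 1"
  then obtain n where "2 * pi * (of_int k / of_nat p) = of_int n * (2 * pi)"
    by (auto simp: chi_def cis_eq_1_iff)
  with p have "real_of_int k = of_int (n * int p)" by (simp add: field_simps)
  then have "k = n * int p" by (simp only: of_int_eq_iff)
  then show "int p dvd k" by simp
next
  assume "p > 0" "int p dvd k"
  then obtain m where "k = int p * m" "p > 0" by auto
  then have "chi p k = cis (2 * pi * of_int m)" by (simp add: chi_def)
  then show "chi p k = 1" by (simp only: cis_multiple_2pi[OF Ints_of_int])
qed

lemma chi_mod: "p > 0 \<Longrightarrow> chi p (l * (k mod int p)) = chi p (l * k)"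
proof -
  assume p: "p > 0"
  have "l * k = l * (k mod int p) + int p * (l * (k div int p))"
    by (metis add.commute distrib_left mod_mult_div_eq mult.left_commute)
  moreover have "chi p (int p * (l * (k div int p))) = 1"
    using p by (simp add: chi_eq_1_iff)
  ultimately show ?thesis by (metis chi_add mult.right_neutral)
qed

text \<open>Translation by 1 permutes the residues and multiplies the sum by \<open>chi p k\<close>,
  so the sum vanishes unless \<open>chi p k = 1\<close>.\<close>

lemma sum_chi:
  assumes "p > 0"
  shows "(\<Sum>s\<in>residues_mod p. chi p (k * s)) = (if int p dvd k then of_nat p else 0)"
proof (cases "int p dvd k")
  case True
  then have "chi p (k * s) = 1" for s using assms by (simp add: chi_eq_1_iff)
  with True show ?thesis by simp
next
  case False
  have "(\<Sum>s\<in>residues_mod p. chi p (k * s)) = (\<Sum>s\<in>residues_mod p. chi p (k * ((1 * s + 1) mod int p)))"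
    by (rule sum_residues_mod_affine[OF assms, symmetric]) simp
  also have "\<dots> = (\<Sum>s\<in>residues_mod p. chi p (k * s)) * chi p k"
    using assms by (simp add: chi_mod chi_add distrib_left sum_distrib_right)
  finally show ?thesis using False chi_eq_1_iff[OF assms, of k] by auto
qed

section \<open>Fourier transform of the walk law\<close>

definition factor :: "real \<Rightarrow> nat \<Rightarrow> int \<Rightarrow> real" where
  "factor \<beta> p k = 1 - 4 * \<beta> * (sin (pi * (of_int k / of_nat p)))\<^sup>2"

text \<open>The transform of one step is
  \<open>1 - 2 * \<beta> + 2 * \<beta> * cos (2 * pi * k / p)\<close>; the double-angle formula
  turns it into \<open>factor\<close>.\<close>

lemma expectation_chi_step:
  assumes "0 \<le> \<beta>" "\<beta> \<le> 1 / 2"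
  shows "(\<Sum>b\<in>{-1, 0, 1}. of_real (pmf (step_pmf \<beta>) b) * chi p (k * b)) = of_real (factor \<beta> p k)"
proof -
  have "chi p k + chi p (- k) = of_real (2 * cos (2 * (pi * (of_int k / of_nat p))))"
    by (simp add: chi_def complex_eq_iff mult.assoc)
  then have 1: "chi p k + chi p (- k) = of_real (2 - 4 * (sin (pi * (of_int k / of_nat p)))\<^sup>2)"
    by (simp only: cos_double_sin) simp
  have "(\<Sum>b\<in>{-1, 0, 1}. of_real (pmf (step_pmf \<beta>) b) * chi p (k * b)) =
      of_real \<beta> * (chi p k + chi p (- k)) + of_real (1 - 2 * \<beta>)"
    using assms by (simp add: pmf_step_pmf algebra_simps)
  also have "\<dots> = of_real (factor \<beta> p k)"
    by (simp only: 1 of_real_mult[symmetric] of_real_add[symmetric]) (simp add: factor_def algebra_simps)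
  finally show ?thesis .
qed

definition char_fun :: "real \<Rightarrow> nat \<Rightarrow> nat \<Rightarrow> int \<Rightarrow> complex" where
  "char_fun \<beta> p n k = (\<Sum>s\<in>residues_mod p. of_real (walk_law \<beta> p n s) * chi p (k * s))"

text \<open>One step of the walk doubles the position and adds an independent term, so the transform
  at time \<open>Suc n\<close> and frequency \<open>k\<close> is the one at time \<open>n\<close>
  and frequency \<open>2 * k\<close>, times \<open>factor \<beta> p k\<close>. Hence the induction
  runs over all \<open>k\<close> at once.\<close>

lemma char_fun_eq:
  assumes "0 \<le> \<beta>" "\<beta> \<le> 1 / 2" "p > 0"
  shows "char_fun \<beta> p n k = of_real (\<Prod>j<n. factor \<beta> p (2 ^ j * k))"
proof (induction n arbitrary: k)
  case 0
  have "char_fun \<beta> p 0 k = (\<Sum>s\<in>residues_mod p. if s = 0 then 1 else 0)"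
    unfolding char_fun_def by (intro sum.cong refl) (auto simp: walk_law_0)
  then show ?case using assms(3) by (simp add: residues_mod_def)
next
  case (Suc n)
  have "char_fun \<beta> p (Suc n) k = (\<Sum>x\<in>residues_mod p. of_real (walk_law \<beta> p n x) *
      (\<Sum>b\<in>{-1, 0, 1}. of_real (pmf (step_pmf \<beta>) b) * chi p (k * (2 * x + b))))"
    unfolding char_fun_def sum_walk_law_Suc[OF assms] chi_mod[OF assms(3)] ..
  also have "\<dots> = (\<Sum>x\<in>residues_mod p. of_real (walk_law \<beta> p n x) * chi p (2 * k * x) *
      (\<Sum>b\<in>{-1, 0, 1}. of_real (pmf (step_pmf \<beta>) b) * chi p (k * b)))"
    by (intro sum.cong refl)
      (simp add: sum_distrib_left distrib_left chi_add mult_ac del: sum.insert)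
  also have "\<dots> = char_fun \<beta> p n (2 * k) * of_real (factor \<beta> p k)"
    by (simp only: expectation_chi_step[OF assms(1,2)] char_fun_def sum_distrib_right)
  also have "\<dots> = of_real (\<Prod>j<Suc n. factor \<beta> p (2 ^ j * k))"
    unfolding Suc.IH prod.lessThan_Suc_shift by (simp add: mult_ac)
  finally show ?case .
qed

text \<open>The total mass is the transform at frequency 0, where every factor is 1.\<close>

lemma sum_walk_law:
  assumes "0 \<le> \<beta>" "\<beta> \<le> 1 / 2" "p > 0"
  shows "(\<Sum>s\<in>residues_mod p. walk_law \<beta> p n s) = 1"
proof -
  have "complex_of_real (\<Sum>s\<in>residues_mod p. walk_law \<beta> p n s) = of_real 1"
    using char_fun_eq[OF assms, of n 0] by (simp add: char_fun_def factor_def)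
  then show ?thesis by (simp only: of_real_eq_iff)
qed

subsection \<open>Products along the cycle of powers of 2\<close>

lemma prod_lessThan_add:
  fixes f :: "nat \<Rightarrow> 'a :: comm_monoid_mult"
  shows "(\<Prod>j<m + n. f j) = (\<Prod>j<m. f j) * (\<Prod>j<n. f (m + j))"
  by (induction n) (simp_all add: mult.assoc)

lemma sum_lessThan_add:
  fixes f :: "nat \<Rightarrow> 'a :: comm_monoid_add"
  shows "(\<Sum>j<m + n. f j) = (\<Sum>j<m. f j) + (\<Sum>j<n. f (m + j))"
  by (induction n) (simp_all add: add.assoc)

lemma sum_periodic_shift:
  fixes f :: "nat \<Rightarrow> 'a :: ab_group_add"
  assumes "\<And>i. f (i + t) = f i"
  shows "(\<Sum>i<t. f (m + i)) = (\<Sum>i<t. f i)"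
proof (induction m)
  case (Suc m)
  have "(\<Sum>i<t. f (Suc m + i)) + f m = (\<Sum>i<Suc t. f (m + i))"
    by (simp only: sum.lessThan_Suc_shift) (simp add: add.commute)
  also have "\<dots> = (\<Sum>i<t. f (m + i)) + f m"
    by (simp add: assms)
  finally show ?case using Suc.IH by simp
qed simp

lemma prod_periodic_shift:
  fixes f :: "nat \<Rightarrow> 'a :: comm_monoid_mult"
  assumes "\<And>i. f (i + t) = f i"
  shows "(\<Prod>i<t. f (m + i)) = (\<Prod>i<t. f i)"
proof (induction m)
  case (Suc m)
  show ?case
  \<comment> \<open>A commutative monoid has no cancellation, so the last factor is split off and
    replaced, by periodicity, with \<open>f m\<close>.\<close>
  proof (cases t)
    case (Suc u)
    have "(\<Prod>i<t. f (Suc m + i)) = (\<Prod>i<u. f (Suc m + i)) * f m"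
      using Suc assms[of m] by simp
    also have "\<dots> = (\<Prod>i<t. f (m + i))"
      unfolding Suc prod.lessThan_Suc_shift by (simp add: mult.commute)
    finally show ?thesis using Suc.IH by simp
  qed simp
qed simp

section \<open>Bounds for a single factor\<close>

lemma chi_cong: "p > 0 \<Longrightarrow> int p dvd k - l \<Longrightarrow> chi p k = chi p l"
  using chi_add[of p "k - l" l] by (simp add: chi_eq_1_iff[symmetric])

lemma sin_squared_eq_Re_chi: "(sin (pi * (of_int k / of_nat p)))\<^sup>2 = (1 - Re (chi p k)) / 2"
  using cos_double_sin[of "pi * (of_int k / of_nat p)"] by (simp add: chi_def mult.assoc)

lemma factor_cong: "p > 0 \<Longrightarrow> int p dvd k - l \<Longrightarrow> factor \<beta> p k = factor \<beta> p l"
  by (simp only: factor_def sin_squared_eq_Re_chi chi_cong)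

text \<open>The sine itself changes sign when \<open>k\<close> grows by \<open>p\<close>; only its
  absolute value depends on \<open>k\<close> mod \<open>p\<close> alone.\<close>

lemma abs_sin_cong:
  "p > 0 \<Longrightarrow> int p dvd k - l \<Longrightarrow>
    \<bar>sin (pi * (of_int k / of_nat p))\<bar> = \<bar>sin (pi * (of_int l / of_nat p))\<bar>"
  by (simp only: abs_eq_iff power2_eq_iff[symmetric] sin_squared_eq_Re_chi chi_cong)

lemma abs_factor_le_1:
  assumes "0 \<le> \<beta>" "\<beta> \<le> 1 / 2"
  shows "\<bar>factor \<beta> p k\<bar> \<le> 1"
proof -
  have "(sin (pi * (of_int k / of_nat p)))\<^sup>2 \<le> 1"
    using sin_squared_eq[of "pi * (of_int k / of_nat p)"] by simp
  then have "\<beta> * (sin (pi * (of_int k / of_nat p)))\<^sup>2 \<le> 1 / 2 * 1"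
    using assms by (intro mult_mono) auto
  then show ?thesis using assms by (simp add: factor_def abs_le_iff)
qed

text \<open>The difference is exactly divisible by the product of the two sines, hence small as soon
  as one of the two angles is near a multiple of \<open>pi\<close>. The cofactor consists of two
  terms, each at most 4 in absolute value for \<open>\<beta> \<le> 1 / 2\<close>.\<close>

lemma factor_diff_bound:
  assumes "0 \<le> \<beta>" "\<beta> \<le> 1 / 2"
  shows "\<bar>factor \<beta> p (k - l) - factor \<beta> p k * factor \<beta> p l\<bar>
    \<le> 8 * (\<bar>sin (pi * (of_int k / of_nat p))\<bar> * \<bar>sin (pi * (of_int l / of_nat p))\<bar>)"
proof -
  define x y where "x = pi * (of_int k / of_nat p)" and "y = pi * (of_int l / of_nat p)"
  have xy: "pi * (of_int (k - l) / of_nat p) = x - y"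
    by (simp add: x_def y_def diff_divide_distrib right_diff_distrib)
  have cos: "(cos x)\<^sup>2 = 1 - (sin x)\<^sup>2" "(cos y)\<^sup>2 = 1 - (sin y)\<^sup>2"
    by (simp_all add: cos_squared_eq)
  have "(sin (x - y))\<^sup>2 = (sin x)\<^sup>2 * (cos y)\<^sup>2 + (cos x)\<^sup>2 * (sin y)\<^sup>2
      - 2 * (sin x * sin y * (cos x * cos y))"
    unfolding sin_diff by algebra
  then have "factor \<beta> p (k - l) - factor \<beta> p k * factor \<beta> p l
      = sin x * sin y * (8 * \<beta> * cos (x - y) - 16 * \<beta>\<^sup>2 * (sin x * sin y))"
    unfolding factor_def xy x_def[symmetric] y_def[symmetric] cos cos_diff by algebra
  moreover have "\<bar>8 * \<beta> * cos (x - y) - 16 * \<beta>\<^sup>2 * (sin x * sin y)\<bar> \<le> 8"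
  proof -
    have "\<bar>\<beta> * cos (x - y)\<bar> \<le> 1 / 2 * 1"
      unfolding abs_mult using assms by (intro mult_mono) auto
    moreover have "\<bar>\<beta>\<^sup>2 * (sin x * sin y)\<bar> \<le> (1 / 2)\<^sup>2 * (1 * 1)"
      unfolding abs_mult using assms by (intro mult_mono) (auto intro: power_mono)
    moreover have "8 * \<beta> * cos (x - y) - 16 * \<beta>\<^sup>2 * (sin x * sin y) =
        8 * (\<beta> * cos (x - y)) - 16 * (\<beta>\<^sup>2 * (sin x * sin y))" by simp
    ultimately show ?thesis by (simp only: power2_eq_square abs_le_iff) linarith
  qed
  ultimately show ?thesis
    unfolding x_def[symmetric] y_def[symmetric]
    by (simp add: abs_mult mult.commute[of 8] mult_left_mono)
qed

section \<open>The product over one doubling cycle mod \<open>2 ^ t - 1\<close>\<close>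

definition cycle_prod :: "real \<Rightarrow> nat \<Rightarrow> int \<Rightarrow> real" where
  "cycle_prod \<beta> t k = (\<Prod>a<t. factor \<beta> (2 ^ t - 1) (2 ^ a * k))"

lemma mersenne_pos: "t > 0 \<Longrightarrow> 2 ^ t - 1 > (0 :: nat)"
  using one_less_power[of "2 :: nat" t] by simp

lemma int_mersenne: "int (2 ^ t - 1) = 2 ^ t - 1"
  by (simp add: of_nat_diff)

lemma mersenne_dvd_shift: "int (2 ^ t - 1) dvd 2 ^ (i + t) * k - 2 ^ i * k"
proof -
  have "2 ^ (i + t) * k - 2 ^ i * k = int (2 ^ t - 1) * (2 ^ i * k)"
    by (simp add: int_mersenne power_add algebra_simps)
  then show ?thesis by simp
qed

lemma factor_mersenne_periodic:
  "t > 0 \<Longrightarrow> factor \<beta> (2 ^ t - 1) (2 ^ (i + t) * k) = factor \<beta> (2 ^ t - 1) (2 ^ i * k)"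
  by (intro factor_cong mersenne_pos mersenne_dvd_shift)

text \<open>Multiplying the frequency by a power of 2 only rotates the cycle.\<close>

lemma cycle_prod_power_mult:
  assumes "t > 0"
  shows "cycle_prod \<beta> t (2 ^ m * k) = cycle_prod \<beta> t k"
proof -
  have "cycle_prod \<beta> t (2 ^ m * k) = (\<Prod>a<t. factor \<beta> (2 ^ t - 1) (2 ^ (m + a) * k))"
    by (simp add: cycle_prod_def power_add mult_ac)
  also have "\<dots> = cycle_prod \<beta> t k"
    unfolding cycle_prod_def by (rule prod_periodic_shift) (rule factor_mersenne_periodic[OF assms])
  finally show ?thesis .
qed

lemma cycle_prod_cong:
  "t > 0 \<Longrightarrow> int (2 ^ t - 1) dvd k - l \<Longrightarrow> cycle_prod \<beta> t k = cycle_prod \<beta> t l"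
  unfolding cycle_prod_def
  by (intro prod.cong refl factor_cong mersenne_pos, assumption)
    (simp only: right_diff_distrib[symmetric] dvd_mult)

lemma abs_cycle_prod_le_1:
  assumes "0 \<le> \<beta>" "\<beta> \<le> 1 / 2"
  shows "\<bar>cycle_prod \<beta> t k\<bar> \<le> 1"
  unfolding cycle_prod_def abs_prod by (intro prod_le_1) (auto intro: abs_factor_le_1 assms)

text \<open>\<open>t * r\<close> doublings run through the cycle \<open>r\<close> times.\<close>

lemma char_fun_mersenne:
  assumes "0 \<le> \<beta>" "\<beta> \<le> 1 / 2" "t > 0"
  shows "char_fun \<beta> (2 ^ t - 1) (t * r) k = of_real (cycle_prod \<beta> t k ^ r)"
proof -
  have "(\<Prod>j<t * r. factor \<beta> (2 ^ t - 1) (2 ^ j * k)) = cycle_prod \<beta> t k ^ r"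
  proof (induction r)
    case (Suc r)
    have "(\<Prod>j<t * Suc r. factor \<beta> (2 ^ t - 1) (2 ^ j * k)) =
        cycle_prod \<beta> t k ^ r * (\<Prod>j<t. factor \<beta> (2 ^ t - 1) (2 ^ (t * r + j) * k))"
      unfolding mult_Suc_right add.commute[of t] prod_lessThan_add Suc.IH ..
    also have "(\<Prod>j<t. factor \<beta> (2 ^ t - 1) (2 ^ (t * r + j) * k)) = cycle_prod \<beta> t k"
      unfolding cycle_prod_def by (rule prod_periodic_shift) (rule factor_mersenne_periodic[OF assms(3)])
    finally show ?case by simp
  qed simp
  then show ?thesis by (simp only: char_fun_eq[OF assms(1,2) mersenne_pos[OF assms(3)]])
qed

section \<open>Comparison of \<open>cycle_prod\<close> at \<open>2 ^ d - 1\<close> with its square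
  at 1\<close>

lemma sum_power4_le: "(\<Sum>a<m. 4 ^ a) \<le> (4 ^ m / 3 :: real)"
  by (induction m) auto

lemma pi_squared_less_10: "pi\<^sup>2 < 10"
proof -
  have "pi\<^sup>2 \<le> 3.15\<^sup>2" using pi_approx pi_gt_zero by (intro power_mono) auto
  then show ?thesis by (simp add: power2_eq_square)
qed

text \<open>The factor 2 pays for replacing the denominator \<open>2 ^ t - 1\<close> by
  \<open>2 ^ t\<close>.\<close>

lemma abs_sin_mersenne_le:
  assumes "t > 0"
  shows "\<bar>sin (pi * (of_int (2 ^ a) / of_nat (2 ^ t - 1)))\<bar> \<le> 2 * pi * 2 ^ a / 2 ^ t"
proof -
  have "\<bar>sin (pi * (of_int (2 ^ a) / of_nat (2 ^ t - 1)))\<bar> \<le> pi * 2 ^ a / (2 ^ t - 1)"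
    using abs_sin_x_le_abs_x[of "pi * (of_int (2 ^ a) / of_nat (2 ^ t - 1))"]
    by (simp add: of_nat_diff abs_mult)
  also have "\<dots> \<le> pi * 2 ^ a / (2 ^ t / 2)"
  proof (rule divide_left_mono)
    have "(2::real) ^ 1 \<le> 2 ^ t" using assms by (intro power_increasing) auto
    then show "2 ^ t / 2 \<le> (2 ^ t - 1 :: real)" "0 < (2 ^ t - 1) * (2 ^ t / 2 :: real)" by auto
  qed auto
  finally show ?thesis by (simp add: mult_ac)
qed

text \<open>The terms grow like \<open>4 ^ a\<close>, so the sum is of the order of its last term,
  where \<open>2 ^ (a + d)\<close> is comparable to \<open>2 ^ t\<close> and \<open>2 ^ a\<close> to
  \<open>2 ^ (t - d)\<close>. The constant is \<open>4 / 3 * pi\<^sup>2\<close> with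
  \<open>pi\<^sup>2 < 10\<close>.\<close>

lemma sum_sin_mersenne_le:
  assumes "t > 0" "d \<le> t"
  shows "(\<Sum>a<t - d. \<bar>sin (pi * (of_int (2 ^ (a + d)) / of_nat (2 ^ t - 1)))\<bar> *
    \<bar>sin (pi * (of_int (2 ^ a) / of_nat (2 ^ t - 1)))\<bar>) \<le> 40 / 3 / 2 ^ d"
proof -
  let ?S = "\<lambda>a. \<bar>sin (pi * (of_int (2 ^ a) / of_nat (2 ^ t - 1)))\<bar>"
  obtain u where t: "t = u + d" using assms(2) by (metis le_add_diff_inverse2)
  have "(\<Sum>a<t - d. ?S (a + d) * ?S a) \<le>
      (\<Sum>a<t - d. (2 * pi * 2 ^ (a + d) / 2 ^ t) * (2 * pi * 2 ^ a / 2 ^ t))"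
    using abs_sin_mersenne_le[OF assms(1)] by (intro sum_mono mult_mono) auto
  also have "\<dots> = 4 * pi\<^sup>2 * 2 ^ d / 4 ^ t * (\<Sum>a<u. 4 ^ a)"
    unfolding sum_distrib_left
    by (intro sum.cong) (auto simp: t power_add power2_eq_square field_simps power_mult_distrib[symmetric])
  also have "\<dots> \<le> 4 * pi\<^sup>2 * 2 ^ d / 4 ^ t * (4 ^ u / 3)"
    by (intro mult_left_mono sum_power4_le) auto
  also have "\<dots> = 4 / 3 * pi\<^sup>2 / 2 ^ d"
  proof -
    have "(4::real) ^ d = 2 ^ d * 2 ^ d" by (simp add: power_mult_distrib[symmetric])
    then show ?thesis by (simp add: t power_add field_simps)
  qed
  also have "\<dots> \<le> 4 / 3 * 10 / 2 ^ d"
    using pi_squared_less_10 by (intro divide_right_mono mult_left_mono) auto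
  finally show ?thesis by simp
qed

text \<open>By \<open>factor_diff_bound\<close> the \<open>a\<close>-th factors differ by at most
  \<open>8 \<bar>sin(\<pi> 2\<^sup>a\<^sup>+\<^sup>d / p)\<bar> \<bar>sin(\<pi> 2\<^sup>a / p)\<bar>\<close>. The terms with \<open>a \<ge> t - d\<close>, where \<open>2\<^sup>a\<^sup>+\<^sup>d\<close> wraps around mod \<open>p\<close>,
  are those of the same sum with \<open>t - d\<close> in place of \<open>d\<close>.\<close>

lemma cycle_prod_diff_bound:
  assumes "0 \<le> \<beta>" "\<beta> \<le> 1 / 2" "t > 0" "d \<le> t"
  shows "\<bar>cycle_prod \<beta> t (2 ^ d - 1) - (cycle_prod \<beta> t 1)\<^sup>2\<bar> \<le> 128 * (1 / 2 ^ d + 1 / 2 ^ (t - d))"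
proof -
  let ?f = "factor \<beta> (2 ^ t - 1)"
  let ?S = "\<lambda>a. \<bar>sin (pi * (of_int (2 ^ a) / of_nat (2 ^ t - 1)))\<bar>"
  have per: "?S (i + t) = ?S i" for i
    using mersenne_dvd_shift[of t i 1] by (intro abs_sin_cong mersenne_pos assms) simp
  \<comment> \<open>By rotation invariance one of the two factors may be taken at frequency
    \<open>2 ^ d\<close>, which pairs the factors at \<open>2 ^ (a + d)\<close> and
    \<open>2 ^ a\<close>.\<close>
  have "(cycle_prod \<beta> t 1)\<^sup>2 = cycle_prod \<beta> t (2 ^ d * 1) * cycle_prod \<beta> t 1"
    by (simp only: cycle_prod_power_mult[OF assms(3)] power2_eq_square)
  also have "\<dots> = (\<Prod>a<t. ?f (2 ^ (a + d)) * ?f (2 ^ a))"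
    by (simp add: cycle_prod_def prod.distrib power_add)
  moreover have "cycle_prod \<beta> t (2 ^ d - 1) = (\<Prod>a<t. ?f (2 ^ (a + d) - 2 ^ a))"
    by (simp add: cycle_prod_def power_add right_diff_distrib)
  ultimately have "\<bar>cycle_prod \<beta> t (2 ^ d - 1) - (cycle_prod \<beta> t 1)\<^sup>2\<bar> =
      norm ((\<Prod>a<t. ?f (2 ^ (a + d) - 2 ^ a)) - (\<Prod>a<t. ?f (2 ^ (a + d)) * ?f (2 ^ a)))"
    by simp
  \<comment> \<open>Telescoping: all factors have modulus at most 1, so the products differ by at
    most the sum of the differences.\<close>
  also have "\<dots> \<le> (\<Sum>a<t. norm (?f (2 ^ (a + d) - 2 ^ a) - ?f (2 ^ (a + d)) * ?f (2 ^ a)))"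
    by (rule norm_prod_diff)
      (auto simp: abs_mult intro!: mult_le_one abs_factor_le_1[OF assms(1,2)])
  also have "\<dots> \<le> (\<Sum>a<t. 8 * (?S (a + d) * ?S a))"
    by (intro sum_mono) (simp only: real_norm_def factor_diff_bound[OF assms(1,2)])
  also have "\<dots> = 8 * (\<Sum>a<(t - d) + d. ?S (a + d) * ?S a)"
    using assms(4) by (simp add: sum_distrib_left)
  also have "(\<Sum>a<(t - d) + d. ?S (a + d) * ?S a) = (\<Sum>a<t - d. ?S (a + d) * ?S a) +
      (\<Sum>i<d. ?S (i + t) * ?S (i + (t - d)))"
    using assms(4) by (simp only: sum_lessThan_add) (simp add: add_ac)
  also have "(\<Sum>i<d. ?S (i + t) * ?S (i + (t - d))) =
      (\<Sum>i<t - (t - d). ?S (i + (t - d)) * ?S i)"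
    unfolding per using assms(4) by (intro sum.cong) (auto simp: mult.commute)
  also have "8 * ((\<Sum>a<t - d. ?S (a + d) * ?S a) + \<dots>) \<le>
      8 * (40 / 3 / 2 ^ d + 40 / 3 / 2 ^ (t - d))"
    by (intro mult_left_mono add_mono sum_sin_mersenne_le) (use assms in auto)
  also have "\<dots> \<le> 128 * (1 / 2 ^ d + 1 / 2 ^ (t - d))"
    by (simp add: divide_simps)
  finally show ?thesis .
qed

section \<open>Lower bounds for \<open>cycle_prod\<close> at 1\<close>

text \<open>The factor at \<open>2 ^ a\<close> differs from 1 by at most a multiple of
  \<open>\<beta> * 4 ^ a\<close>, and these deviations sum geometrically. The case
  \<open>m = t\<close> serves small \<open>\<beta>\<close>; \<open>m = t - 2\<close> leaves out just
  the last two factors.\<close>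

lemma partial_cycle_prod_near_1:
  assumes "0 \<le> \<beta>" "\<beta> \<le> 1 / 2" "t > 0"
  shows "\<bar>(\<Prod>a<m. factor \<beta> (2 ^ t - 1) (2 ^ a)) - 1\<bar> \<le> \<beta> * (40 / 3) * (2 ^ m / (2 ^ t - 1))\<^sup>2"
proof -
  let ?p = "2 ^ t - 1 :: real"
  have p: "?p > 0" using assms(3) by simp
  have "norm ((\<Prod>a<m. factor \<beta> (2 ^ t - 1) (2 ^ a)) - (\<Prod>a<m. 1)) \<le>
      (\<Sum>a<m. norm (factor \<beta> (2 ^ t - 1) (2 ^ a) - 1))"
    by (rule norm_prod_diff) (auto intro: abs_factor_le_1 assms)
  also have "\<dots> \<le> (\<Sum>a<m. 4 * \<beta> * pi\<^sup>2 / ?p\<^sup>2 * 4 ^ a)"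
  proof (rule sum_mono)
    fix a
    have "norm (factor \<beta> (2 ^ t - 1) (2 ^ a) - 1) = 4 * \<beta> * \<bar>sin (pi * (2 ^ a / ?p))\<bar>\<^sup>2"
      using assms by (simp add: factor_def of_nat_diff abs_mult)
    also have "\<dots> \<le> 4 * \<beta> * \<bar>pi * (2 ^ a / ?p)\<bar>\<^sup>2"
      by (intro mult_left_mono power_mono abs_sin_x_le_abs_x) (use assms in auto)
    also have "\<dots> = 4 * \<beta> * pi\<^sup>2 / ?p\<^sup>2 * 4 ^ a"
      by (simp add: power_mult_distrib power_divide power2_eq_square)
        (simp add: power_mult_distrib[symmetric])
    finally show "norm (factor \<beta> (2 ^ t - 1) (2 ^ a) - 1) \<le> 4 * \<beta> * pi\<^sup>2 / ?p\<^sup>2 * 4 ^ a" .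
  qed
  also have "\<dots> \<le> 4 * \<beta> * pi\<^sup>2 / ?p\<^sup>2 * (4 ^ m / 3)"
    unfolding sum_distrib_left[symmetric]
    using assms by (intro mult_left_mono sum_power4_le) auto
  also have "\<dots> = pi\<^sup>2 * (4 / 3 * \<beta> * (2 ^ m / ?p)\<^sup>2)"
    using p by (simp add: power_divide power2_eq_square power_mult_distrib[symmetric] field_simps)
  also have "\<dots> \<le> 10 * (4 / 3 * \<beta> * (2 ^ m / ?p)\<^sup>2)"
    using assms pi_squared_less_10 by (intro mult_right_mono) auto
  finally show ?thesis by simp
qed

text \<open>Since \<open>2 ^ t / (2 ^ t - 1) \<le> 2\<close>, the full product is within
  \<open>160 / 3 * \<beta>\<close> of 1. The bound is informative for
  \<open>\<beta> < 1 / 54\<close>.\<close>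

lemma cycle_prod_1_ge:
  assumes "0 \<le> \<beta>" "\<beta> \<le> 1 / 2" "t > 0"
  shows "\<bar>cycle_prod \<beta> t 1\<bar> \<ge> 1 - 54 * \<beta>"
proof -
  have "(2::real) ^ 1 \<le> 2 ^ t" using assms by (intro power_increasing) auto
  then have "2 ^ t / (2 ^ t - 1 :: real) \<le> 2" by (simp add: divide_simps)
  then have "(2 ^ t / (2 ^ t - 1 :: real))\<^sup>2 \<le> 2\<^sup>2" by (intro power_mono) auto
  then have "\<beta> * (40 / 3) * (2 ^ t / (2 ^ t - 1))\<^sup>2 \<le> \<beta> * (40 / 3) * 2\<^sup>2"
    using assms by (intro mult_left_mono) auto
  with partial_cycle_prod_near_1[OF assms, of t]
  have "\<bar>cycle_prod \<beta> t 1 - 1\<bar> \<le> \<beta> * (40 / 3) * 2\<^sup>2"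
    unfolding cycle_prod_def mult_1_right by (rule order.trans)
  then show ?thesis using assms(1) by (simp add: abs_le_iff abs_if split: if_splits)
qed

text \<open>The last two factors, at angles tending to \<open>pi / 2\<close> and
  \<open>pi / 4\<close>, converge to \<open>1 - 4 * \<beta>\<close> and
  \<open>1 - 2 * \<beta>\<close>, which are nonzero by the exclusion of \<open>1 / 4\<close> and
  \<open>1 / 2\<close>. The remaining product stays away from 0.\<close>

lemma eventually_cycle_prod_1_ge:
  assumes "0 < \<beta>" "\<beta> \<le> 1 / 2" "\<beta> \<noteq> 1 / 4" "\<beta> \<noteq> 1 / 2"
  obtains \<gamma> where "0 < \<gamma>" "\<gamma> < 1" "\<forall>\<^sub>F t in sequentially. \<bar>cycle_prod \<beta> t 1\<bar> \<ge> \<gamma>"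
proof -
  define l where "l = \<bar>1 - 2 * \<beta>\<bar> * \<bar>1 - 4 * \<beta>\<bar>"
  have "\<bar>1 - 2 * \<beta>\<bar> * \<bar>1 - 4 * \<beta>\<bar> \<le> 1 * 1"
    using assms by (intro mult_mono) auto
  then have l: "0 < l" "l \<le> 1" using assms by (auto simp: l_def)
  \<comment> \<open>With \<open>t = m + 2\<close> the last two exponents are \<open>m + 1\<close>
    and \<open>m\<close>, which avoids truncated subtraction.\<close>
  let ?f = "\<lambda>m k. factor \<beta> (2 ^ (m + 2) - 1) (2 ^ (m + k))"
  have half: "(\<lambda>m. 2 ^ (m + 1) / (2 ^ (m + 2) - 1) :: real) \<longlonglongrightarrow> 1 / 2"
    by real_asymp
  have "(\<lambda>m. 2 ^ m / (2 ^ (m + 2) - 1) :: real) =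
      (\<lambda>m. 1 / 2 * (2 ^ (m + 1) / (2 ^ (m + 2) - 1)))" by simp
  with tendsto_mult[OF tendsto_const half, of "1 / 2"]
  have quarter: "(\<lambda>m. 2 ^ m / (2 ^ (m + 2) - 1) :: real) \<longlonglongrightarrow> 1 / 4"
    by (simp only:) simp
  have "(\<lambda>m. 1 - 4 * \<beta> * (sin (pi * h m))\<^sup>2) \<longlonglongrightarrow> 1 - 4 * \<beta> * (sin (pi * z))\<^sup>2"
    if "h \<longlonglongrightarrow> z" for h :: "nat \<Rightarrow> real" and z
    by (intro tendsto_intros that)
  from this[OF half] this[OF quarter]
  have "(\<lambda>m. ?f m 1) \<longlonglongrightarrow> 1 - 4 * \<beta>" "(\<lambda>m. ?f m 0) \<longlonglongrightarrow> 1 - 2 * \<beta>"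
    by (simp_all add: factor_def of_nat_diff sin_45 power_divide)
  then have "(\<lambda>m. \<bar>?f m 0\<bar> * \<bar>?f m 1\<bar>) \<longlonglongrightarrow> l"
    unfolding l_def by (intro tendsto_intros)
  then have "\<forall>\<^sub>F m in sequentially. \<bar>?f m 0\<bar> * \<bar>?f m 1\<bar> > l / 2"
    using l by (intro order_tendstoD(1)) auto
  then have "\<forall>\<^sub>F m in sequentially. \<bar>cycle_prod \<beta> (m + 2) 1\<bar> \<ge> 2 / 5 * (l / 2)"
    using eventually_ge_at_top[of 1]
  proof eventually_elim
    case (elim m)
    let ?Q = "\<Prod>a<m. factor \<beta> (2 ^ (m + 2) - 1) (2 ^ a)"
    have "(2::real) ^ 1 \<le> 2 ^ m" using elim by (intro power_increasing) auto
    \<comment> \<open>The ratio decreases in \<open>m\<close> and equals \<open>2 / 7\<close> at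
      \<open>m = 1\<close>. Even for \<open>\<beta> = 1 / 2\<close> this keeps \<open>?Q\<close>
      within \<open>80 / 147 < 3 / 5\<close> of 1.\<close>
    then have "0 \<le> 2 ^ m / (2 ^ (m + 2) - 1 :: real)" "2 ^ m / (2 ^ (m + 2) - 1 :: real) \<le> 2 / 7"
      by (auto simp: divide_simps)
    then have "(2 ^ m / (2 ^ (m + 2) - 1 :: real))\<^sup>2 \<le> (2 / 7)\<^sup>2" by (intro power_mono)
    then have "\<beta> * (40 / 3) * (2 ^ m / (2 ^ (m + 2) - 1))\<^sup>2 \<le> 1 / 2 * (40 / 3) * (2 / 7)\<^sup>2"
      using assms by (intro mult_mono) auto
    moreover have "\<bar>?Q - 1\<bar> \<le> \<beta> * (40 / 3) * (2 ^ m / (2 ^ (m + 2) - 1))\<^sup>2"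
      using assms by (intro partial_cycle_prod_near_1) auto
    moreover have "1 / 2 * (40 / 3) * (2 / 7)\<^sup>2 \<le> (3 / 5 :: real)"
      by (simp add: power2_eq_square)
    ultimately have "\<bar>?Q - 1\<bar> \<le> 3 / 5" by linarith
    then have "\<bar>?Q\<bar> \<ge> 2 / 5" by linarith
    then have "2 / 5 * (l / 2) \<le> \<bar>?Q\<bar> * (\<bar>?f m 0\<bar> * \<bar>?f m 1\<bar>)"
      using elim l by (intro mult_mono) auto
    also have "\<dots> = \<bar>cycle_prod \<beta> (m + 2) 1\<bar>"
      by (simp add: cycle_prod_def abs_mult)
    finally show ?case .
  qed
  then have "\<forall>\<^sub>F t in sequentially. \<bar>cycle_prod \<beta> t 1\<bar> \<ge> l / 5"
    by (subst (asm) eventually_sequentially_seg) simp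
  with l show ?thesis by (intro that[of "l / 5"]) auto
qed

subsection \<open>The second moment bound\<close>

text \<open>If the variance of \<open>f\<close> under \<open>P\<close> is small against
  \<open>(cmod m)\<^sup>2\<close>, then \<open>f\<close> concentrates near \<open>m\<close>; if its
  second moment under \<open>Q\<close> is, then \<open>f\<close> stays near 0 there. So
  \<open>P\<close> and \<open>Q\<close> have little common mass. The first bracket is the variance
  under \<open>P\<close> divided by \<open>(cmod m)\<^sup>2\<close>.\<close>

lemma variation_distance_second_moment:
  fixes P Q :: "'a \<Rightarrow> real" and f :: "'a \<Rightarrow> complex"
  assumes nonneg: "\<And>s. s \<in> G \<Longrightarrow> 0 \<le> P s" "\<And>s. s \<in> G \<Longrightarrow> 0 \<le> Q s"
    and sums: "(\<Sum>s\<in>G. P s) = 1" "(\<Sum>s\<in>G. Q s) = 1"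
    and m: "(\<Sum>s\<in>G. of_real (P s) * f s) = m" "m \<noteq> 0"
  shows "1 - 2 * ((\<Sum>s\<in>G. P s * (cmod (f s))\<^sup>2) / (cmod m)\<^sup>2 - 1)
      - 2 * ((\<Sum>s\<in>G. Q s * (cmod (f s))\<^sup>2) / (cmod m)\<^sup>2) \<le> variation_distance G P Q"
proof -
  define M where "M = (cmod m)\<^sup>2"
  have M: "M > 0" using m(2) by (simp add: M_def)
  have expand: "(cmod (f s - m))\<^sup>2 = (cmod (f s))\<^sup>2 + M - 2 * Re (f s * cnj m)" for s
    unfolding M_def cmod_power2 by (simp add: power2_eq_square algebra_simps)
  have "(\<Sum>s\<in>G. P s * Re (f s * cnj m)) = Re (\<Sum>s\<in>G. of_real (P s) * f s * cnj m)"
    unfolding Re_sum by (intro sum.cong refl) (simp add: mult.assoc algebra_simps)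
  also have "\<dots> = Re (m * cnj m)"
    by (simp only: sum_distrib_right[symmetric] m(1))
  also have "\<dots> = M" unfolding M_def cmod_power2 by (simp add: power2_eq_square)
  finally have cross: "(\<Sum>s\<in>G. P s * Re (f s * cnj m)) = M" .
  have "(\<Sum>s\<in>G. P s * (cmod (f s - m))\<^sup>2) = (\<Sum>s\<in>G. P s * (cmod (f s))\<^sup>2) + M * (\<Sum>s\<in>G. P s)
      - 2 * (\<Sum>s\<in>G. P s * Re (f s * cnj m))"
    unfolding expand sum_distrib_left sum.distrib[symmetric] sum_subtractf[symmetric]
    by (intro sum.cong refl) (simp add: algebra_simps)
  then have var: "(\<Sum>s\<in>G. P s * (cmod (f s - m))\<^sup>2) = (\<Sum>s\<in>G. P s * (cmod (f s))\<^sup>2) - M"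
    by (simp only: cross sums)
  have "P s / 2 + Q s / 2 - 2 / M * (P s * (cmod (f s - m))\<^sup>2) - 2 / M * (Q s * (cmod (f s))\<^sup>2)
      \<le> 1 / 2 * \<bar>P s - Q s\<bar>" if "s \<in> G" for s
  proof -
    \<comment> \<open>Chebyshev: \<open>f s\<close> cannot be close to both \<open>m\<close> and \<open>0\<close>, and \<open>\<bar>P - Q\<bar> = P + Q - 2 min P Q\<close>.\<close>
    define u where "u = min (P s) (Q s)"
    have u: "0 \<le> u" "u \<le> P s" "u \<le> Q s" using nonneg that by (auto simp: u_def)
    have "cmod m \<le> cmod (f s) + cmod (f s - m)"
      using norm_triangle_ineq4[of "f s" "f s - m"] by simp
    then have "M \<le> (cmod (f s) + cmod (f s - m))\<^sup>2"
      unfolding M_def by (intro power_mono) auto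
    also have "\<dots> \<le> 2 * (cmod (f s))\<^sup>2 + 2 * (cmod (f s - m))\<^sup>2"
      using zero_le_power2[of "cmod (f s) - cmod (f s - m)"] by (simp add: power2_sum power2_diff)
    finally have "u * M \<le> u * (2 * (cmod (f s))\<^sup>2 + 2 * (cmod (f s - m))\<^sup>2)"
      using u by (intro mult_left_mono) auto
    also have "\<dots> \<le> 2 * (Q s * (cmod (f s))\<^sup>2) + 2 * (P s * (cmod (f s - m))\<^sup>2)"
      using mult_right_mono[OF u(3), of "(cmod (f s))\<^sup>2"]
        mult_right_mono[OF u(2), of "(cmod (f s - m))\<^sup>2"] by (simp add: algebra_simps)
    finally have "u \<le> 2 / M * (P s * (cmod (f s - m))\<^sup>2) + 2 / M * (Q s * (cmod (f s))\<^sup>2)"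
      using M by (simp add: field_simps)
    moreover have "1 / 2 * \<bar>P s - Q s\<bar> = P s / 2 + Q s / 2 - u"
      by (simp add: u_def min_def abs_if field_simps)
    ultimately show ?thesis by simp
  qed
  then have "(\<Sum>s\<in>G. P s / 2 + Q s / 2 - 2 / M * (P s * (cmod (f s - m))\<^sup>2)
      - 2 / M * (Q s * (cmod (f s))\<^sup>2)) \<le> (\<Sum>s\<in>G. 1 / 2 * \<bar>P s - Q s\<bar>)"
    by (rule sum_mono)
  also have "(\<Sum>s\<in>G. P s / 2 + Q s / 2 - 2 / M * (P s * (cmod (f s - m))\<^sup>2)
      - 2 / M * (Q s * (cmod (f s))\<^sup>2)) = 1 - 2 / M * (\<Sum>s\<in>G. P s * (cmod (f s - m))\<^sup>2)
      - 2 / M * (\<Sum>s\<in>G. Q s * (cmod (f s))\<^sup>2)"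
    by (simp only: sum_subtractf sum.distrib sum_distrib_left[symmetric] sum_divide_distrib[symmetric] sums)
  also have "\<dots> = 1 - 2 * ((\<Sum>s\<in>G. P s * (cmod (f s))\<^sup>2) / M - 1)
      - 2 * ((\<Sum>s\<in>G. Q s * (cmod (f s))\<^sup>2) / M)"
    unfolding var using M by (simp add: field_simps)
  finally show ?thesis
    by (simp only: variation_distance_def M_def sum_distrib_left)
qed

section \<open>Moments of the test function\<close>

text \<open>The sum of the characters along the doubling orbit of 1: under the walk at multiples of
  \<open>t\<close> they all have the same mean, while under the uniform law they are
  orthogonal.\<close>

definition test_fun :: "nat \<Rightarrow> int \<Rightarrow> complex" where
  "test_fun t s = (\<Sum>j<t. chi (2 ^ t - 1) (2 ^ j * s))"

text \<open>Expanding the square gives characters at differences of powers of 2. The weight is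
  arbitrary, so that both the uniform law and the walk law are covered.\<close>

lemma weighted_test_fun_square:
  "complex_of_real (\<Sum>s\<in>G. w s * (cmod (test_fun t s))\<^sup>2) =
    (\<Sum>k<t. \<Sum>j<t. \<Sum>s\<in>G. of_real (w s) * chi (2 ^ t - 1) ((2 ^ j - 2 ^ k) * s))"
proof -
  have "complex_of_real (w s * (cmod (test_fun t s))\<^sup>2) =
      (\<Sum>k<t. \<Sum>j<t. of_real (w s) * chi (2 ^ t - 1) ((2 ^ j - 2 ^ k) * s))" for s
  proof -
    have chi: "chi (2 ^ t - 1) (2 ^ j * s) * chi (2 ^ t - 1) (- (2 ^ k * s)) =
        chi (2 ^ t - 1) ((2 ^ j - 2 ^ k) * s)" for j k
      unfolding chi_add[symmetric] by (simp add: left_diff_distrib)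
    have "test_fun t s * cnj (test_fun t s) =
        (\<Sum>j<t. \<Sum>k<t. chi (2 ^ t - 1) ((2 ^ j - 2 ^ k) * s))"
      by (simp only: test_fun_def cnj_sum cnj_chi sum_product chi)
    also have "\<dots> = (\<Sum>k<t. \<Sum>j<t. chi (2 ^ t - 1) ((2 ^ j - 2 ^ k) * s))"
      by (rule sum.swap)
    finally show ?thesis
      by (simp only: of_real_mult complex_norm_square sum_distrib_left)
  qed
  then have "complex_of_real (\<Sum>s\<in>G. w s * (cmod (test_fun t s))\<^sup>2) =
      (\<Sum>s\<in>G. \<Sum>k<t. \<Sum>j<t. of_real (w s) * chi (2 ^ t - 1) ((2 ^ j - 2 ^ k) * s))"
    by (simp only: of_real_sum)
  also have "\<dots> = (\<Sum>k<t. \<Sum>s\<in>G. \<Sum>j<t. of_real (w s) * chi (2 ^ t - 1) ((2 ^ j - 2 ^ k) * s))"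
    by (rule sum.swap)
  also have "\<dots> = (\<Sum>k<t. \<Sum>j<t. \<Sum>s\<in>G. of_real (w s) * chi (2 ^ t - 1) ((2 ^ j - 2 ^ k) * s))"
    by (rule sum.cong[OF refl], rule sum.swap)
  finally show ?thesis .
qed

lemma mersenne_dvd_power_diff_iff:
  assumes "j < t" "k < t"
  shows "int (2 ^ t - 1) dvd 2 ^ j - 2 ^ k \<longleftrightarrow> j = k"
proof
  assume dvd: "int (2 ^ t - 1) dvd 2 ^ j - 2 ^ k"
  have "(2::int) ^ j \<le> 2 ^ (t - 1)" "(2::int) ^ k \<le> 2 ^ (t - 1)"
    using assms by (auto intro!: power_increasing)
  moreover have "(2::int) ^ t = 2 * 2 ^ (t - 1)"
    using assms by (metis One_nat_def Suc_pred less_nat_zero_code not_gr_zero power_Suc)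
  moreover have "(2::int) ^ j \<ge> 1" "(2::int) ^ k \<ge> 1" by simp_all
  ultimately have "\<bar>2 ^ j - 2 ^ k\<bar> < \<bar>(2::int) ^ t - 1\<bar>" by linarith
  moreover have "2 ^ j - 2 ^ k = (0 :: int)"
  proof (rule ccontr)
    assume "2 ^ j - 2 ^ k \<noteq> (0 :: int)"
    from dvd_imp_le_int[OF this dvd] calculation show False unfolding int_mersenne by linarith
  qed
  ultimately show "j = k" by simp
qed simp

lemma uniform_test_fun_square:
  assumes "t > 0"
  shows "(\<Sum>s\<in>residues_mod (2 ^ t - 1). uniform_on (residues_mod (2 ^ t - 1)) s * (cmod (test_fun t s))\<^sup>2) = t"
proof -
  let ?p = "2 ^ t - 1 :: nat"
  have aux: "of_real (1 / real N) * of_nat N = (1 :: complex)" if "N > 0" for N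
    using that by simp
  have "(\<Sum>s\<in>residues_mod ?p. of_real (uniform_on (residues_mod ?p) s) * chi ?p ((2 ^ j - 2 ^ k) * s)) =
      (if j = k then 1 else 0)" if "j < t" "k < t" for j k
    unfolding uniform_on_def card_residues_mod sum_distrib_left[symmetric]
      sum_chi[OF mersenne_pos[OF assms]] mersenne_dvd_power_diff_iff[OF that]
    using aux[OF mersenne_pos[OF assms]]
    by (cases "j = k") (simp_all only: simp_thms if_True if_False mult_zero_right)
  then have "complex_of_real (\<Sum>s\<in>residues_mod ?p. uniform_on (residues_mod ?p) s * (cmod (test_fun t s))\<^sup>2)
      = (\<Sum>k<t. \<Sum>j<t. if j = k then 1 else 0)"
    unfolding weighted_test_fun_square by (intro sum.cong refl) auto
  also have "\<dots> = of_real t" by simp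
  finally show ?thesis by (simp only: of_real_eq_iff)
qed

lemma walk_test_fun_mean:
  assumes "0 \<le> \<beta>" "\<beta> \<le> 1 / 2" "t > 0"
  shows "(\<Sum>s\<in>residues_mod (2 ^ t - 1). of_real (walk_law \<beta> (2 ^ t - 1) (t * r) s) * test_fun t s) =
    of_real (t * cycle_prod \<beta> t 1 ^ r)"
proof -
  have "(\<Sum>s\<in>residues_mod (2 ^ t - 1). of_real (walk_law \<beta> (2 ^ t - 1) (t * r) s) * test_fun t s) =
      (\<Sum>j<t. char_fun \<beta> (2 ^ t - 1) (t * r) (2 ^ j))"
    unfolding test_fun_def char_fun_def sum_distrib_left by (rule sum.swap)
  also have "\<dots> = (\<Sum>j<t. of_real (cycle_prod \<beta> t (2 ^ j * 1) ^ r))"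
    by (simp only: char_fun_mersenne[OF assms] mult_1_right)
  also have "\<dots> = of_real (t * cycle_prod \<beta> t 1 ^ r)"
    by (simp only: cycle_prod_power_mult[OF assms(3)]) simp
  finally show ?thesis .
qed

text \<open>Multiplied by \<open>2 ^ (t - k)\<close>, the frequency \<open>2 ^ j - 2 ^ k\<close>
  becomes congruent to \<open>2 ^ (t - k + j) - 1\<close>, with the same \<open>cycle_prod\<close>.
  The double sum thus depends only on the difference of exponents mod \<open>t\<close>.\<close>

lemma walk_test_fun_square:
  assumes "0 \<le> \<beta>" "\<beta> \<le> 1 / 2" "t > 0"
  shows "(\<Sum>s\<in>residues_mod (2 ^ t - 1). walk_law \<beta> (2 ^ t - 1) (t * r) s * (cmod (test_fun t s))\<^sup>2) =
    t * (\<Sum>d<t. cycle_prod \<beta> t (2 ^ d - 1) ^ r)"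
proof -
  let ?p = "2 ^ t - 1 :: nat"
  let ?F = "\<lambda>d. cycle_prod \<beta> t (2 ^ d - 1) ^ r"
  have per: "?F (i + t) = ?F i" for i
    using mersenne_dvd_shift[of t i 1]
    by (intro arg_cong[where f = "\<lambda>x. x ^ r"] cycle_prod_cong assms) simp
  have cyc: "cycle_prod \<beta> t (2 ^ j - 2 ^ k) = cycle_prod \<beta> t (2 ^ (t - k + j) - 1)" if "k < t" for j k
  proof -
    have "cycle_prod \<beta> t (2 ^ j - 2 ^ k) = cycle_prod \<beta> t (2 ^ (t - k) * (2 ^ j - 2 ^ k))"
      by (rule cycle_prod_power_mult[OF assms(3), symmetric])
    also have "2 ^ (t - k) * (2 ^ j - 2 ^ k) = 2 ^ (t - k + j) - (2 ^ t :: int)"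
      using that by (simp add: right_diff_distrib power_add[symmetric])
    also have "cycle_prod \<beta> t \<dots> = cycle_prod \<beta> t (2 ^ (t - k + j) - 1)"
    proof (rule cycle_prod_cong[OF assms(3)])
      have "2 ^ (t - k + j) - 2 ^ t - (2 ^ (t - k + j) - 1) = - int (2 ^ t - 1)"
        unfolding int_mersenne by simp
      then show "int (2 ^ t - 1) dvd 2 ^ (t - k + j) - 2 ^ t - (2 ^ (t - k + j) - 1)"
        by (simp only: dvd_minus_iff dvd_refl)
    qed
    finally show ?thesis .
  qed
  have "complex_of_real (\<Sum>s\<in>residues_mod ?p. walk_law \<beta> ?p (t * r) s * (cmod (test_fun t s))\<^sup>2)
      = (\<Sum>k<t. \<Sum>j<t. of_real (?F (t - k + j)))"
    unfolding weighted_test_fun_square char_fun_def[symmetric] char_fun_mersenne[OF assms]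
    by (intro sum.cong refl) (simp only: cyc lessThan_iff)
  also have "\<dots> = of_real (\<Sum>k<t. \<Sum>j<t. ?F (t - k + j))"
    by (simp only: of_real_sum)
  \<comment> \<open>For fixed \<open>k\<close> the index \<open>t - k + j\<close> runs through a
    full period.\<close>
  also have "(\<Sum>k<t. \<Sum>j<t. ?F (t - k + j)) = (\<Sum>k<t. \<Sum>d<t. ?F d)"
    by (rule sum.cong[OF refl], rule sum_periodic_shift[where f = ?F], rule per)
  finally show ?thesis by (simp only: of_real_eq_iff sum_constant card_lessThan)
qed

section \<open>The second moment relative to the squared mean\<close>

text \<open>\<open>L\<close> is a cutoff. The at most \<open>2 * L\<close> indices \<open>d\<close>
  near 0 or \<open>t\<close> are bounded trivially through
  \<open>\<bar>cycle_prod\<bar> \<le> 1\<close>. For the others \<open>cycle_prod\<close> at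
  \<open>2 ^ d - 1\<close> is at most \<open>1 + y\<close> times its square at 1, and
  \<open>(1 + y) ^ r \<le> exp (y * r)\<close>.\<close>

lemma cycle_prod_second_moment_bound:
  assumes "0 \<le> \<beta>" "\<beta> \<le> 1 / 2" "t > 0" "0 < \<gamma>" "\<gamma> \<le> \<bar>cycle_prod \<beta> t 1\<bar>"
  shows "(\<Sum>d<t. cycle_prod \<beta> t (2 ^ d - 1) ^ r) / (t * cycle_prod \<beta> t 1 ^ (2 * r))
    \<le> 2 * real L / (t * \<gamma> ^ (2 * r)) + exp (256 / \<gamma>\<^sup>2 / 2 ^ L * r)"
proof -
  define q where "q = (cycle_prod \<beta> t 1)\<^sup>2"
  define y where "y = 256 / \<gamma>\<^sup>2 / 2 ^ L"
  have y: "y \<ge> 0" using assms by (simp add: y_def)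
  have "\<gamma>\<^sup>2 \<le> \<bar>cycle_prod \<beta> t 1\<bar>\<^sup>2" using assms by (intro power_mono) auto
  then have q: "\<gamma>\<^sup>2 \<le> q" by (simp add: q_def)
  moreover have \<gamma>: "\<gamma>\<^sup>2 > 0" using assms by simp
  ultimately have q0: "q > 0" by linarith
  have qr: "1 / q ^ r \<le> 1 / (\<gamma>\<^sup>2) ^ r"
    using q \<gamma> by (intro divide_left_mono power_mono mult_pos_pos zero_less_power q0) (use assms in auto)
  \<comment> \<open>In each case one summand alone suffices; their sum gives a single formula for
    all \<open>d\<close>.\<close>
  have bound: "cycle_prod \<beta> t (2 ^ d - 1) ^ r / q ^ r \<le>
      (if d < L \<or> t - L < d then 1 / (\<gamma>\<^sup>2) ^ r else 0) + exp (y * r)" if "d < t" for d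
  proof (cases "d < L \<or> t - L < d")
    case True
    have "cycle_prod \<beta> t (2 ^ d - 1) ^ r \<le> \<bar>cycle_prod \<beta> t (2 ^ d - 1)\<bar> ^ r"
      by (simp add: power_abs[symmetric])
    also have "\<dots> \<le> 1" using abs_cycle_prod_le_1[OF assms(1,2)] by (intro power_le_one) auto
    finally have "cycle_prod \<beta> t (2 ^ d - 1) ^ r / q ^ r \<le> 1 / q ^ r"
      using q0 by (intro divide_right_mono) auto
    with qr have "cycle_prod \<beta> t (2 ^ d - 1) ^ r / q ^ r \<le> 1 / (\<gamma>\<^sup>2) ^ r" by linarith
    with True show ?thesis by (simp add: add_increasing2)
  next
    case False
    then have d: "L \<le> d" "L \<le> t - d" using that by auto
    have "\<bar>cycle_prod \<beta> t (2 ^ d - 1) - q\<bar> \<le> 128 * (1 / 2 ^ d + 1 / 2 ^ (t - d))"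
      unfolding q_def using assms that by (intro cycle_prod_diff_bound) auto
    also have "\<dots> \<le> 128 * (1 / 2 ^ L + 1 / 2 ^ L)"
      using d by (intro mult_left_mono add_mono divide_left_mono power_increasing) auto
    also have "\<dots> = y * \<gamma>\<^sup>2" using \<gamma> by (simp add: y_def)
    also have "\<dots> \<le> y * q" using q y by (rule mult_left_mono)
    finally have "\<bar>cycle_prod \<beta> t (2 ^ d - 1)\<bar> \<le> (1 + y) * q"
      using q0 by (simp add: algebra_simps abs_le_iff)
    then have "\<bar>cycle_prod \<beta> t (2 ^ d - 1)\<bar> / q \<le> 1 + y"
      using q0 by (simp add: field_simps)
    also have "\<dots> \<le> exp y" by (rule exp_ge_add_one_self)
    finally have "(\<bar>cycle_prod \<beta> t (2 ^ d - 1)\<bar> / q) ^ r \<le> exp y ^ r"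
      using q0 by (intro power_mono) auto
    moreover have "cycle_prod \<beta> t (2 ^ d - 1) ^ r / q ^ r \<le> (\<bar>cycle_prod \<beta> t (2 ^ d - 1)\<bar> / q) ^ r"
      using q0 unfolding power_divide by (intro divide_right_mono) (auto simp: power_abs[symmetric])
    ultimately show ?thesis using False by (simp add: exp_of_nat_mult[symmetric] mult.commute)
  qed
  have "card {d \<in> {..<t}. d < L \<or> t - L < d} \<le> card ({..<L} \<union> {t - L<..<t})"
    by (intro card_mono) auto
  also have "\<dots> \<le> card {..<L} + card {t - L<..<t}" by (rule card_Un_le)
  also have "\<dots> \<le> 2 * L" by simp
  finally have card: "real (card {d \<in> {..<t}. d < L \<or> t - L < d}) \<le> 2 * real L"
    using of_nat_mono[of _ "2 * L", where 'a = real] by simp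
  have "(\<Sum>d<t. cycle_prod \<beta> t (2 ^ d - 1) ^ r) / q ^ r \<le>
      (\<Sum>d<t. (if d < L \<or> t - L < d then 1 / (\<gamma>\<^sup>2) ^ r else 0) + exp (y * r))"
    unfolding sum_divide_distrib using bound by (intro sum_mono) auto
  also have "\<dots> = card {d \<in> {..<t}. d < L \<or> t - L < d} * (1 / (\<gamma>\<^sup>2) ^ r) + t * exp (y * r)"
    by (simp add: sum.distrib sum.If_cases Int_def)
  also have "\<dots> \<le> 2 * real L * (1 / (\<gamma>\<^sup>2) ^ r) + t * exp (y * r)"
    by (intro add_mono mult_right_mono card) (use \<gamma> in auto)
  finally have "(\<Sum>d<t. cycle_prod \<beta> t (2 ^ d - 1) ^ r) / q ^ r / t \<le>
      (2 * real L * (1 / (\<gamma>\<^sup>2) ^ r) + t * exp (y * r)) / t"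
    by (intro divide_right_mono) auto
  also have "\<dots> = 2 * real L / (t * \<gamma> ^ (2 * r)) + exp (y * r)"
    using assms by (simp add: add_divide_distrib power_mult)
  finally show ?thesis by (simp add: q_def y_def power_mult[symmetric] mult.commute)
qed

lemma variation_distance_mersenne_ge:
  assumes "0 \<le> \<beta>" "\<beta> \<le> 1 / 2" "t > 0" "0 < \<gamma>" "\<gamma> \<le> \<bar>cycle_prod \<beta> t 1\<bar>"
  shows "1 - 2 * (2 * real L / (t * \<gamma> ^ (2 * r)) + exp (256 / \<gamma>\<^sup>2 / 2 ^ L * r) - 1) - 2 / (t * \<gamma> ^ (2 * r))
    \<le> variation_distance (residues_mod (2 ^ t - 1)) (walk_law \<beta> (2 ^ t - 1) (t * r))
        (uniform_on (residues_mod (2 ^ t - 1)))"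
proof -
  let ?c = "cycle_prod \<beta> t 1"
  have aux: "real N * (1 / real N) = 1" if "N > 0" for N
    using that by simp
  have c: "?c \<noteq> 0" using assms by auto
  have m2: "(cmod (of_real (t * ?c ^ r)))\<^sup>2 = t\<^sup>2 * ?c ^ (2 * r)"
    by (simp only: norm_of_real power2_abs) (simp add: power_mult_distrib power_mult[symmetric] mult.commute)
  have "\<gamma> ^ (2 * r) \<le> \<bar>?c\<bar> ^ (2 * r)" using assms by (intro power_mono) auto
  then have "\<gamma> ^ (2 * r) \<le> ?c ^ (2 * r)" by (simp add: power_mult)
  then have u: "2 / (t * ?c ^ (2 * r)) \<le> 2 / (t * \<gamma> ^ (2 * r))"
    using assms c by (intro divide_left_mono mult_left_mono mult_pos_pos) (auto simp: power_mult)
  have "1 - 2 * ((\<Sum>s\<in>residues_mod (2 ^ t - 1). walk_law \<beta> (2 ^ t - 1) (t * r) s * (cmod (test_fun t s))\<^sup>2)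
        / (cmod (of_real (t * ?c ^ r)))\<^sup>2 - 1)
      - 2 * ((\<Sum>s\<in>residues_mod (2 ^ t - 1). uniform_on (residues_mod (2 ^ t - 1)) s * (cmod (test_fun t s))\<^sup>2)
        / (cmod (of_real (t * ?c ^ r)))\<^sup>2)
    \<le> variation_distance (residues_mod (2 ^ t - 1)) (walk_law \<beta> (2 ^ t - 1) (t * r))
        (uniform_on (residues_mod (2 ^ t - 1)))"
  proof (rule variation_distance_second_moment)
    show "(\<Sum>s\<in>residues_mod (2 ^ t - 1). uniform_on (residues_mod (2 ^ t - 1)) s) = 1"
      unfolding uniform_on_def sum_constant card_residues_mod by (rule aux[OF mersenne_pos[OF assms(3)]])
    show "(\<Sum>s\<in>residues_mod (2 ^ t - 1). walk_law \<beta> (2 ^ t - 1) (t * r) s) = 1"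
      by (intro sum_walk_law mersenne_pos assms)
  qed (use walk_test_fun_mean[OF assms(1-3)] c assms(3) in
      \<open>auto simp: walk_law_nonneg uniform_on_def simp del: One_nat_def\<close>)
  note this[unfolded m2 walk_test_fun_square[OF assms(1-3)] uniform_test_fun_square[OF assms(3)]]
  moreover have "t * x / (t\<^sup>2 * z) = x / (t * z)" "2 * (t / (t\<^sup>2 * z)) = 2 / (t * z)" for x z :: real
    using assms(3) by (simp_all add: power2_eq_square)
  ultimately have "1 - 2 * ((\<Sum>d<t. cycle_prod \<beta> t (2 ^ d - 1) ^ r) / (t * ?c ^ (2 * r)) - 1)
      - 2 / (t * ?c ^ (2 * r))
    \<le> variation_distance (residues_mod (2 ^ t - 1)) (walk_law \<beta> (2 ^ t - 1) (t * r))
        (uniform_on (residues_mod (2 ^ t - 1)))"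
    by (simp only:)
  moreover have "1 - 2 * (B - 1) - w \<le> V"
    if "1 - 2 * (A - 1) - u \<le> V" "A \<le> B" "u \<le> w" for A B u w V :: real
    using that by simp
  ultimately show ?thesis
    using cycle_prod_second_moment_bound[OF assms, of r L] u by blast
qed

subsection \<open>Asymptotics\<close>

lemma nat_ceiling_bounds:
  fixes x :: real
  assumes "x \<ge> 0"
  shows "x \<le> real (nat \<lceil>x\<rceil>)" "real (nat \<lceil>x\<rceil>) \<le> x + 1"
proof -
  have "real (nat \<lceil>x\<rceil>) = of_int \<lceil>x\<rceil>" using assms by simp
  then show "x \<le> real (nat \<lceil>x\<rceil>)" "real (nat \<lceil>x\<rceil>) \<le> x + 1" by linarith+
qed

text \<open>Every admissible \<open>n\<close> is at most \<open>t * r\<close> with \<open>r\<close>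
  about \<open>c * ln t\<close>. Since the distance decreases in \<open>n\<close>, the bound at time
  \<open>t * r\<close> suffices, and with \<open>L\<close> about \<open>ln t\<close> it tends to
  1.\<close>

lemma slow_mixing:
  assumes \<beta>: "0 \<le> \<beta>" "\<beta> \<le> 1 / 2" and \<gamma>: "0 < \<gamma>" "\<gamma> < 1"
    and ev: "\<forall>\<^sub>F t in sequentially. \<gamma> \<le> \<bar>cycle_prod \<beta> t 1\<bar>" and "\<epsilon> > 0"
  shows "\<exists>t0::nat. \<forall>t\<ge>t0. \<forall>p n :: nat.
    p = 2 ^ t - 1 \<longrightarrow> real n \<le> 1 / (4 * ln (1 / \<gamma>)) * ln (real p) * ln (ln (real p)) \<longrightarrow>
    variation_distance (residues_mod p) (walk_law \<beta> p n) (uniform_on (residues_mod p)) > 1 - \<epsilon>"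
proof -
  \<comment> \<open>With \<open>r\<close> about \<open>c * ln t\<close>, the constant 4 makes
    \<open>\<gamma> ^ (2 * r)\<close> of order \<open>1 / sqrt t\<close>, so
    \<open>t * \<gamma> ^ (2 * r)\<close> still grows like \<open>sqrt t\<close>.\<close>
  define c where "c = 1 / (4 * ln (1 / \<gamma>))"
  define K where "K = 256 / \<gamma>\<^sup>2"
  have ln\<gamma>: "ln (1 / \<gamma>) > 0" using \<gamma> by simp
  then have c: "c > 0" by (simp add: c_def)
  have K: "K > 0" using \<gamma> by (simp add: K_def)
  \<comment> \<open>The bound of \<open>variation_distance_mersenne_ge\<close> with the roundings in
    \<open>r\<close> and \<open>L\<close> replaced by their worst cases.\<close>
  define b where "b = (\<lambda>x. 1 - 2 * (2 * (ln x + 1) / (sqrt x * \<gamma>\<^sup>2) + exp (K * (c * ln x + 1) / 2 powr ln x) - 1)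
      - 2 / (sqrt x * \<gamma>\<^sup>2) :: real)"
  have G: "\<gamma>\<^sup>2 > 0" using \<gamma> by simp
  have lims: "(\<lambda>t::nat. 2 * (ln t + 1) / (sqrt t * G)) \<longlonglongrightarrow> 0" "(\<lambda>t::nat. 2 / (sqrt t * G)) \<longlonglongrightarrow> 0"
    if "G > 0" for G
    using that by real_asymp+
  have "(\<lambda>t::nat. K * (c * ln t + 1) / 2 powr ln t) \<longlonglongrightarrow> 0"
    using c K by real_asymp
  then have "(\<lambda>t. b (real t)) \<longlonglongrightarrow> 1 - 2 * (0 + exp 0 - 1) - 0"
    unfolding b_def by (intro tendsto_intros lims[OF G])
  then have "(\<lambda>t. b (real t)) \<longlonglongrightarrow> 1" by simp
  then have "\<forall>\<^sub>F t in sequentially. b (real t) > 1 - \<epsilon>"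
    using \<open>\<epsilon> > 0\<close> by (intro order_tendstoD(1)) auto
  then have "\<forall>\<^sub>F t in sequentially. \<forall>p n :: nat.
    p = 2 ^ t - 1 \<longrightarrow> real n \<le> c * ln (real p) * ln (ln (real p)) \<longrightarrow>
    variation_distance (residues_mod p) (walk_law \<beta> p n) (uniform_on (residues_mod p)) > 1 - \<epsilon>"
    using ev eventually_ge_at_top[of 2]
  proof eventually_elim
    case (elim t)
    define r where "r = nat \<lceil>c * ln t\<rceil>"
    \<comment> \<open>Two demands on the cutoff: \<open>L / sqrt t\<close> tends to 0, and
      \<open>2 ^ L\<close>, at least \<open>t\<close> to the power \<open>ln 2\<close>, outgrows
      \<open>r\<close>.\<close>
    define L where "L = nat \<lceil>ln t\<rceil>"
    let ?p = "2 ^ t - 1 :: nat"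
    have ln_t: "ln (real t) > 0" using elim by simp
    have r: "c * ln t \<le> r" "r \<le> c * ln t + 1"
      using nat_ceiling_bounds[of "c * ln t"] c ln_t by (simp_all add: r_def)
    have L: "ln t \<le> L" "L \<le> ln t + 1"
      using nat_ceiling_bounds[of "ln t"] ln_t by (simp_all add: L_def)
    have "2 powr ln t \<le> 2 powr L" using L by (intro powr_mono) auto
    then have L2: "2 powr ln t \<le> 2 ^ L" by (simp add: powr_realpow)
    \<comment> \<open>The extra \<open>\<gamma>\<^sup>2\<close> absorbs the rounding up in
      \<open>r\<close>.\<close>
    have "sqrt t * \<gamma>\<^sup>2 \<le> t * \<gamma> ^ (2 * r)"
    proof -
      have "2 * r * ln (1 / \<gamma>) \<le> 2 * (c * ln t + 1) * ln (1 / \<gamma>)"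
        using r ln\<gamma> by (intro mult_right_mono mult_left_mono) auto
      also have "\<dots> = ln t / 2 - 2 * ln \<gamma>"
        using ln\<gamma> \<gamma> by (simp add: c_def ln_div field_simps)
      finally have "ln t / 2 + 2 * ln \<gamma> \<le> ln t + (2 * r) * ln \<gamma>"
        using \<gamma> by (simp add: ln_div)
      then have "exp (ln t / 2 + 2 * ln \<gamma>) \<le> exp (ln t + (2 * r) * ln \<gamma>)" by simp
      also have "exp (ln t + (2 * r) * ln \<gamma>) = t * \<gamma> ^ (2 * r)"
        using elim \<gamma> by (simp add: exp_add exp_of_nat_mult del: of_nat_mult)
      also have "exp (ln t / 2 + 2 * ln \<gamma>) = sqrt t * \<gamma>\<^sup>2"
        using elim \<gamma> exp_of_nat_mult[of 2 "ln \<gamma>"]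
        by (simp add: exp_add ln_sqrt[symmetric])
      finally show ?thesis .
    qed
    moreover have pos: "sqrt t * \<gamma>\<^sup>2 > 0" using elim \<gamma> by simp
    ultimately have tg: "x / (t * \<gamma> ^ (2 * r)) \<le> x / (sqrt t * \<gamma>\<^sup>2)" if "x \<ge> 0" for x
      using that by (intro divide_left_mono mult_pos_pos) (use elim \<gamma> in auto)
    have X: "2 * real L / (t * \<gamma> ^ (2 * r)) \<le> 2 * (ln t + 1) / (sqrt t * \<gamma>\<^sup>2)"
    proof -
      have "2 * real L / (t * \<gamma> ^ (2 * r)) \<le> 2 * real L / (sqrt t * \<gamma>\<^sup>2)" by (rule tg) simp
      also have "\<dots> \<le> 2 * (ln t + 1) / (sqrt t * \<gamma>\<^sup>2)"
        using L pos by (intro divide_right_mono) auto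
      finally show ?thesis .
    qed
    have Y: "exp (256 / \<gamma>\<^sup>2 / 2 ^ L * r) \<le> exp (K * (c * ln t + 1) / 2 powr ln t)"
    proof -
      have "K * r / 2 ^ L \<le> K * (c * ln t + 1) / 2 powr ln t"
        using r L2 K c ln_t by (intro frac_le mult_left_mono) (auto intro!: mult_nonneg_nonneg add_nonneg_nonneg)
      then show ?thesis by (simp add: K_def)
    qed
    have "b t \<le> 1 - 2 * (2 * real L / (t * \<gamma> ^ (2 * r)) + exp (256 / \<gamma>\<^sup>2 / 2 ^ L * r) - 1) - 2 / (t * \<gamma> ^ (2 * r))"
      unfolding b_def by (intro diff_mono mult_left_mono add_mono X Y tg order.refl) auto
    also have "\<dots> \<le> variation_distance (residues_mod ?p) (walk_law \<beta> ?p (t * r)) (uniform_on (residues_mod ?p))"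
      using elim by (intro variation_distance_mersenne_ge \<beta> \<gamma>) auto
    finally have main: "1 - \<epsilon> < variation_distance (residues_mod ?p) (walk_law \<beta> ?p (t * r)) (uniform_on (residues_mod ?p))"
      using elim by linarith
    show ?case
    proof (intro allI impI)
      fix p n :: nat
      assume p: "p = 2 ^ t - 1" and n: "real n \<le> c * ln (real p) * ln (ln (real p))"
      have "(2::nat) ^ 2 \<le> 2 ^ t" using elim by (intro power_increasing) auto
      then have p3: "p \<ge> 3" by (simp add: p)
      \<comment> \<open>From \<open>ln p \<le> t\<close> the range of \<open>n\<close> lies below
        \<open>c * t * ln t\<close>, hence below \<open>t * r\<close>.\<close>
      have "real p \<le> 2 ^ t" by (simp add: p of_nat_diff)
      then have "ln (real p) \<le> t * ln 2"
        using p3 by (subst ln_realpow[symmetric]) auto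
      moreover have "t * ln 2 \<le> t * (1 :: real)"
        using ln_2_less_1 by (intro mult_left_mono) auto
      ultimately have lnp: "ln (real p) \<le> t" by linarith
      have lnp0: "ln (real p) > 0" using p3 by simp
      have "ln (ln (real p)) \<le> ln t" using lnp lnp0 elim by simp
      then have "c * ln (real p) * ln (ln (real p)) \<le> c * ln (real p) * ln t"
        using c lnp0 by (intro mult_left_mono) auto
      moreover have "c * ln (real p) * ln t \<le> c * t * ln t"
        using c lnp ln_t by (intro mult_right_mono mult_left_mono) auto
      moreover have "c * t * ln t \<le> t * r"
        using mult_left_mono[OF r(1), of t] by (simp add: mult_ac)
      ultimately have "real n \<le> real (t * r)" using n unfolding of_nat_mult by linarith
      then have "n \<le> t * r" by (simp only: of_nat_le_iff)
      moreover have "odd p" using elim by (simp add: p)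
      ultimately show "1 - \<epsilon> < variation_distance (residues_mod p) (walk_law \<beta> p n) (uniform_on (residues_mod p))"
        using main variation_distance_walk_law_antimono[OF \<beta>, of p n "t * r"] unfolding p by linarith
    qed
  qed
  then show ?thesis unfolding c_def eventually_sequentially .
qed

theorem mainTheorem2:
  shows "\<exists>c :: real \<Rightarrow> real.
    (\<forall>\<beta>\<in>{0<..1/2} - {1/4, 1/2}. c \<beta> > 0) \<and>
    filterlim c at_top (at_right 0) \<and>
    (\<forall>\<beta>\<in>{0<..1/2} - {1/4, 1/2}. \<forall>\<epsilon>>0. \<exists>t0::nat. \<forall>t\<ge>t0. \<forall>p n :: nat.
       p = 2 ^ t - 1 \<longrightarrow> real n \<le> c \<beta> * ln (real p) * ln (ln (real p)) \<longrightarrow>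
       variation_distance (residues_mod p) (walk_law \<beta> p n) (uniform_on (residues_mod p)) > 1 - \<epsilon>)"
proof -
  define good where "good = (\<lambda>\<beta> \<gamma>. 0 < \<gamma> \<and> \<gamma> < 1 \<and>
    (\<forall>\<^sub>F t in sequentially. \<gamma> \<le> \<bar>cycle_prod \<beta> t 1\<bar>))"
  \<comment> \<open>The explicit value near 0 makes \<open>c\<close> computable there, for the
    limit; elsewhere any admissible \<open>\<gamma>\<close> will do.\<close>
  define g where "g = (\<lambda>\<beta>. if \<beta> < 1 / 54 then 1 - 54 * \<beta> else SOME \<gamma>. good \<beta> \<gamma>)"
  define c where "c = (\<lambda>\<beta>. 1 / (4 * ln (1 / g \<beta>)))"
  have good: "good \<beta> (g \<beta>)" if \<beta>: "\<beta> \<in> {0<..1/2} - {1/4, 1/2}" for \<beta>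
  proof (cases "\<beta> < 1 / 54")
    case True
    have "\<forall>\<^sub>F t in sequentially. 1 - 54 * \<beta> \<le> \<bar>cycle_prod \<beta> t 1\<bar>"
      using eventually_gt_at_top[of 0] by eventually_elim (use that in \<open>auto intro!: cycle_prod_1_ge\<close>)
    with True that show ?thesis by (simp add: good_def g_def)
  next
    case False
    obtain \<gamma> where "good \<beta> \<gamma>"
      by (rule eventually_cycle_prod_1_ge[of \<beta>]) (use \<beta> in \<open>auto simp: good_def\<close>)
    with False show ?thesis by (simp add: g_def someI[of "good \<beta>"])
  qed
  have "filterlim (\<lambda>\<beta>. 1 / (4 * ln (1 / (1 - 54 * \<beta>))) :: real) at_top (at_right 0)"
    by real_asymp
  \<comment> \<open>Agreement with the explicit formula on \<open>0 < \<beta> < 1 / 54\<close>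
    determines the limit at 0 from the right.\<close>
  moreover have "\<forall>\<^sub>F \<beta> in at_right 0. 1 / (4 * ln (1 / (1 - 54 * \<beta>))) = c \<beta>"
    using eventually_at_right_less[of 0] eventually_at_right_real[of 0 "1 / 54"]
    by (auto simp: c_def g_def elim: eventually_mono)
  ultimately have "filterlim c at_top (at_right 0)"
    by (rule filterlim_cong[THEN iffD1, OF refl refl, rotated])
  moreover have "c \<beta> > 0" if "\<beta> \<in> {0<..1/2} - {1/4, 1/2}" for \<beta>
    using good[OF that] by (simp add: good_def c_def)
  moreover have "\<exists>t0::nat. \<forall>t\<ge>t0. \<forall>p n :: nat.
       p = 2 ^ t - 1 \<longrightarrow> real n \<le> c \<beta> * ln (real p) * ln (ln (real p)) \<longrightarrow>
       variation_distance (residues_mod p) (walk_law \<beta> p n) (uniform_on (residues_mod p)) > 1 - \<epsilon>"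
    if "\<beta> \<in> {0<..1/2} - {1/4, 1/2}" "\<epsilon> > 0" for \<beta> \<epsilon>
    using good[OF that(1)] that unfolding good_def c_def by (intro slow_mixing) auto
  ultimately show ?thesis by blast
qed

end
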